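(* Fix a time step $k\ge 1$ and let $(p_h^{n,k},\boldsymbol z_h^{n,k},\boldsymbol u_h^{n,k})_{n}$ be the iterates of the fixed stress split scheme for the fully discrete Biot model with frictionless Signorini contact. That is, $p_h^{k-1}\in Q_h$ and $\boldsymbol u_h^{k-1}\in V_h$ (previous time step) and starting values $p_h^{0,k}\in Q_h$, $\boldsymbol u_h^{0,k}\in V_h$ are given, and for every $n\ge 0$ the following hold. (a) Flow step: $p_h^{n+1,k}\in Q_h$ and $\boldsymbol z_h^{n+1,k}\in Z_h$ satisfy, for all $\theta_h\in Q_h$, $$\Big(\big(\tfrac1M+c_f\varphi_0+\tfrac{\alpha^2}{\lambda}\big)\tfrac{p_h^{n+1,k}-p_h^{k-1}}{\Delta t},\theta_h\Big)+\tfrac1{\mu_f}\big(\nabla\cdot\boldsymbol z_h^{n+1,k},\theta_h\big)=\Big(-\tfrac{\alpha}{\lambda}\Big(-\alpha\,\tfrac{p_h^{n,k}-p_h^{k-1}}{\Delta t}+\lambda\nabla\cdot\tfrac{\boldsymbol u_h^{n,k}-\boldsymbol u_h^{k-1}}{\Delta t}\Big),\theta_h\Big)+(q_h,\theta_h),$$ and, for all $\boldsymbol q_h\in Z_h$, $$\big(\boldsymbol K^{-1}\boldsymbol z_h^{n+1,k},\boldsymbol q_h\big)=\big(p_h^{n+1,k},\nabla\cdot\boldsymbol q_h\big)+\big(\nabla(\rho_{f,r}g\eta),\boldsymbol q_h\big).$$ (b) Mechanics step: $\boldsymbol u_h^{n+1,k}\in V_h$ satisfies, for all $\boldsymbol v_h\in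 V_h$, $$2G\big(\boldsymbol\varepsilon(\boldsymbol u_h^{n+1,k}),\boldsymbol\varepsilon(\boldsymbol v_h)-\boldsymbol\varepsilon(\boldsymbol u_h^{n+1,k})\big)+\big(\lambda\nabla\cdot\boldsymbol u_h^{n+1,k},\nabla\cdot\boldsymbol v_h-\nabla\cdot\boldsymbol u_h^{n+1,k}\big)-\alpha\big(p_h^{n+1,k},\nabla\cdot\boldsymbol v_h-\nabla\cdot\boldsymbol u_h^{n+1,k}\big)\ \ge\ \big(\boldsymbol f_0,\boldsymbol v_h-\boldsymbol u_h^{n+1,k}\big)+\big(\boldsymbol f_2,\boldsymbol v_h-\boldsymbol u_h^{n+1,k}\big)_{\Gamma_2}.$$ For $n\ge1$ put $\delta p_h^{n,k}=p_h^{n,k}-p_h^{n-1,k}$, $\delta\boldsymbol u_h^{n,k}=\boldsymbol u_h^{n,k}-\boldsymbol u_h^{n-1,k}$ and $\delta\sigma_v^{n,k}=\lambda\nabla\cdot\delta\boldsymbol u_h^{n,k}-\alpha\,\delta p_h^{n,k}$, and put $\delta\boldsymbol z_h^{n+1,k}=\boldsymbol z_h^{n+1,k}-\boldsymbol z_h^{n,k}$. Let $$\beta=\frac1{M\alpha^2}+\frac{c_f}{\alpha^2}\varphi_0+\frac1\lambda .$$ Then the scheme is a contraction in the following sense: $\big(\frac{1}{\lambda\beta}\big)^2<1$ and, for every $n\ge1$, $$\big\|\delta\sigma_v^{n+1,k}\big\|_\Omega^2+\frac{2\Delta t}{\mu_f\beta}\big\|\boldsymbol K^{-1/2}\delta\boldsymbol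 z_h^{n+1,k}\big\|_\Omega^2+4G\lambda\big\|\boldsymbol\varepsilon(\delta\boldsymbol u_h^{n+1,k})\big\|_\Omega^2+\lambda^2\big\|\nabla\cdot\delta\boldsymbol u_h^{n+1,k}\big\|_\Omega^2\ \le\ \Big(\frac1{\lambda\beta}\Big)^2\big\|\delta\sigma_v^{n,k}\big\|_\Omega^2 .$$
   Context: Domain. $\Omega\subset\mathbb R^d$, $d=2,3$, is a bounded domain with smooth boundary $\Gamma=\Gamma_1\cup\Gamma_2\cup\Gamma_3$, the $\Gamma_i$ pairwise disjoint, $\mathrm{meas}(\Gamma_1)>0$; $\boldsymbol\nu$ is the unit outward normal on $\Gamma$ and $v_\nu=\boldsymbol v\cdot\boldsymbol\nu$. Notation. $(\cdot,\cdot)$ and $\|\cdot\|_\Omega$ are the $L^2(\Omega)$ inner product and norm (for scalar, vector or tensor fields), $(\cdot,\cdot)_{\Gamma_2}$ is the $L^2(\Gamma_2)$ inner product, and $\boldsymbol\varepsilon(\boldsymbol u)=\frac12(\nabla\boldsymbol u+\nabla\boldsymbol u^T)$ is the linearized strain. Parameters. $\lambda>0$ and $G>0$ are the (constant) Lamé parameters, $\alpha>0$ the Biot coefficient, $M>0$ the Biot modulus, $c_f\ge0$ the fluid compressibility, $\varphi_0\ge0$ the reference porosity, $\mu_f>0$ the fluid viscosity, and $\Delta t>0$ the time step, all constant. $\boldsymbol K$ is the permeability tensor, a symmetric, bounded, uniformly positive definite matrix field on $\Omega$. The constants $\rho_{f,r}$ and $g$ are the reference fluid density and gravitational acceleration,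 and $\eta$ is a given elevation function. Data. $g_a\ge0$ is a given scalar function on $\Gamma_3$ (gap function). $\boldsymbol f_0$ (body force on $\Omega$), $\boldsymbol f_2$ (traction on $\Gamma_2$), the source $q_h$ and $\nabla(\rho_{f,r}g\eta)$ are given square-integrable data, independent of the iteration index $n$. Spaces. The admissible displacements form the convex set $$V_u=\{\boldsymbol v\in H^1(\Omega)^d:\ \boldsymbol v=0\text{ on }\Gamma_1,\ v_\nu\le g_a\text{ on }\Gamma_3\}.$$ Let $\mathfrak T_h$ be a member of a regular family of conforming triangulations (simplicial elements) of $\overline\Omega$, and let $\mathbb P_j$ denote polynomials of degree at most $j$. Define $$V_h=\{\boldsymbol v_h\in V_u:\ \boldsymbol v_h|_T\in\mathbb P_1^d\ \ \forall T\in\mathfrak T_h\},$$ $$Q_h=\{p_h\in L^2(\Omega):\ p_h|_T\in\mathbb P_0\ \ \forall T\in\mathfrak T_h,\ p_h=0\text{ on }\Gamma\},$$ $$Z_h=\{\boldsymbol q_h\in H(\mathrm{div};\Omega):\ \boldsymbol q_h|_T\in\mathbb P_1^d\ \ \forall T\in\mathfrak T_h,\ \boldsymbol q_h\cdot\boldsymbol\nu=0\text{ on }\Gamma\}.$$ Indices. $k$ is the time-step index (fixed) and $n$ is the index of the flow/mechanics coupling iteration. The volumetric mean total stress at iteration $n$ is $\sigma_v^{n,k}=\sigma_v^{k-1}+\lambda\nabla\cdot\boldsymbol u_h^{n,k}-\alpha(p_h^{n,k}-p_h^{k-1})$; its increments between consecutive iterations are $\delta\sigma_v^{n,k}=\lambda\nabla\cdot\delta\boldsymbol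 u_h^{n,k}-\alpha\,\delta p_h^{n,k}$. *)

theory Defs
  imports "HOL-Analysis.Analysis"
begin

section \<open>Square-integrable fields\<close>

text \<open>For matrix fields, of type \<open>real^'n^'n\<close>, the inner product is the Frobenius one.\<close>

definition square_integrable :: "'a measure \<Rightarrow> ('a \<Rightarrow> 'b::euclidean_space) \<Rightarrow> bool" where
  "square_integrable M f \<longleftrightarrow>
     f \<in> borel_measurable M \<and> integrable M (\<lambda>x. (norm (f x))\<^sup>2)"

definition L2_inner :: "'a measure \<Rightarrow> ('a \<Rightarrow> 'b::euclidean_space) \<Rightarrow> ('a \<Rightarrow> 'b) \<Rightarrow> real" where
  "L2_inner M f g = (LINT x|M. f x \<bullet> g x)"

definition L2_norm :: "'a measure \<Rightarrow> ('a \<Rightarrow> 'b::euclidean_space) \<Rightarrow> real" where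
  "L2_norm M f = sqrt (L2_inner M f f)"

definition locally_integrable_on :: "('a::euclidean_space \<Rightarrow> 'b::euclidean_space) \<Rightarrow> 'a set \<Rightarrow> bool"
    (infixr "locally'_integrable'_on" 46) where
  "f locally_integrable_on \<Omega> \<longleftrightarrow>
     (\<forall>C. compact C \<and> C \<subseteq> \<Omega> \<longrightarrow> f absolutely_integrable_on C)"


section \<open>Smooth functions and classical gradients\<close>

text \<open>Only used with \<open>S\<close> open.\<close>

fun Ck_on :: "nat \<Rightarrow> (real^'n \<Rightarrow> 'b::real_normed_vector) \<Rightarrow> (real^'n) set \<Rightarrow> bool" where
  "Ck_on 0 f S \<longleftrightarrow> continuous_on S f"
| "Ck_on (Suc k) f S \<longleftrightarrow> (\<forall>x\<in>S. f differentiable (at x)) \<and>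
     (\<forall>i. Ck_on k (\<lambda>x. frechet_derivative f (at x) (axis i 1)) S)"

definition smooth_on :: "(real^'n \<Rightarrow> 'b::real_normed_vector) \<Rightarrow> (real^'n) set \<Rightarrow> bool"
    (infixr "smooth'_on" 46) where
  "f smooth_on S \<longleftrightarrow> (\<forall>k. Ck_on k f S)"

definition grad :: "(real^'n \<Rightarrow> real) \<Rightarrow> real^'n \<Rightarrow> real^'n" where
  "grad f x = (\<chi> i. frechet_derivative f (at x) (axis i 1))"

definition test_functions :: "(real^'n) set \<Rightarrow> (real^'n \<Rightarrow> real) set" where
  "test_functions \<Omega> = {\<phi>. \<phi> smooth_on UNIV \<and>
     compact (closure {x. \<phi> x \<noteq> 0}) \<and> closure {x. \<phi> x \<noteq> 0} \<subseteq> \<Omega>}"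


section \<open>Smooth domains, surface measure and unit outward normal\<close>

definition defining_function ::
    "(real^'n) set \<Rightarrow> real^'n \<Rightarrow> (real^'n) set \<Rightarrow> (real^'n \<Rightarrow> real) \<Rightarrow> bool" where
  "defining_function \<Omega> x U \<rho> \<longleftrightarrow> open U \<and> x \<in> U \<and> \<rho> smooth_on U \<and>
     (\<forall>y\<in>U. grad \<rho> y \<noteq> 0) \<and> \<Omega> \<inter> U = {y\<in>U. \<rho> y < 0}"

definition smooth_boundary :: "(real^'n) set \<Rightarrow> bool" where
  "smooth_boundary \<Omega> \<longleftrightarrow> (\<forall>x\<in>frontier \<Omega>. \<exists>U \<rho>. defining_function \<Omega> x U \<rho>)"

text \<open>On the boundary of a smooth domain the normal does not depend on the choice of \<open>\<rho>\<close>.\<close>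

definition outward_normal :: "(real^'n) set \<Rightarrow> real^'n \<Rightarrow> real^'n" where
  "outward_normal \<Omega> x =
     (SOME n. \<exists>U \<rho>. defining_function \<Omega> x U \<rho> \<and> n = grad \<rho> x /\<^sub>R norm (grad \<rho> x))"

text \<open>The \<open>m\<close>-dimensional Hausdorff outer measure, normalised so that it agrees with surface
  area on smooth hypersurfaces; it is meant for \<open>m > 0\<close>.\<close>

definition hausdorff_pre :: "nat \<Rightarrow> real \<Rightarrow> 'a::metric_space set \<Rightarrow> ennreal" where
  "hausdorff_pre m \<delta> A =
     (INF C\<in>{C::nat \<Rightarrow> 'a set. A \<subseteq> (\<Union>i. C i) \<and> (\<forall>i. bounded (C i) \<and> diameter (C i) \<le> \<delta>)}.
        \<Sum>i. ennreal (unit_ball_vol (real m) * (diameter (C i) / 2) ^ m))"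

definition hausdorff_outer :: "nat \<Rightarrow> 'a::metric_space set \<Rightarrow> ennreal" where
  "hausdorff_outer m A = (SUP \<delta>\<in>{0<..}. hausdorff_pre m \<delta> A)"

text \<open>The measure lives on the Caratheodory-measurable sets, so it is complete.\<close>

definition surface_measure :: "(real^'n) measure" where
  "surface_measure =
     measure_of UNIV (lambda_system UNIV UNIV (hausdorff_outer (CARD('n) - 1)))
       (hausdorff_outer (CARD('n) - 1))"

abbreviation surface_on :: "(real^'n) set \<Rightarrow> (real^'n) measure" where
  "surface_on S \<equiv> restrict_space surface_measure S"


section \<open>Weak derivatives, Sobolev spaces and traces\<close>

text \<open>Functions are representatives of almost-everywhere classes; \<open>weak_grad\<close> and \<open>weak_div\<close>
  pick a representative of the weak gradient and of the weak divergence.\<close>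

definition is_weak_grad :: "(real^'n) set \<Rightarrow> (real^'n \<Rightarrow> real) \<Rightarrow> (real^'n \<Rightarrow> real^'n) \<Rightarrow> bool" where
  "is_weak_grad \<Omega> f G \<longleftrightarrow> f locally_integrable_on \<Omega> \<and> G locally_integrable_on \<Omega> \<and>
     (\<forall>\<phi>\<in>test_functions \<Omega>. \<forall>j.
        (LINT x|lebesgue_on \<Omega>. f x * grad \<phi> x $ j) = - (LINT x|lebesgue_on \<Omega>. G x $ j * \<phi> x))"

definition weak_grad :: "(real^'n) set \<Rightarrow> (real^'n \<Rightarrow> real) \<Rightarrow> real^'n \<Rightarrow> real^'n" where
  "weak_grad \<Omega> f = (SOME G. is_weak_grad \<Omega> f G)"

definition H1 :: "(real^'n) set \<Rightarrow> (real^'n \<Rightarrow> real) set" where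
  "H1 \<Omega> = {f. square_integrable (lebesgue_on \<Omega>) f \<and>
     (\<exists>G. is_weak_grad \<Omega> f G \<and> square_integrable (lebesgue_on \<Omega>) G)}"

definition H1_vec :: "(real^'n) set \<Rightarrow> (real^'n \<Rightarrow> real^'n) set" where
  "H1_vec \<Omega> = {v. \<forall>i. (\<lambda>x. v x $ i) \<in> H1 \<Omega>}"

definition is_weak_div :: "(real^'n) set \<Rightarrow> (real^'n \<Rightarrow> real^'n) \<Rightarrow> (real^'n \<Rightarrow> real) \<Rightarrow> bool" where
  "is_weak_div \<Omega> q d \<longleftrightarrow> q locally_integrable_on \<Omega> \<and> d locally_integrable_on \<Omega> \<and>
     (\<forall>\<phi>\<in>test_functions \<Omega>.
        (LINT x|lebesgue_on \<Omega>. q x \<bullet> grad \<phi> x) = - (LINT x|lebesgue_on \<Omega>. d x * \<phi> x))"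

definition weak_div :: "(real^'n) set \<Rightarrow> (real^'n \<Rightarrow> real^'n) \<Rightarrow> real^'n \<Rightarrow> real" where
  "weak_div \<Omega> q = (SOME d. is_weak_div \<Omega> q d)"

definition Hdiv :: "(real^'n) set \<Rightarrow> (real^'n \<Rightarrow> real^'n) set" where
  "Hdiv \<Omega> = {q. square_integrable (lebesgue_on \<Omega>) q \<and>
     (\<exists>d. is_weak_div \<Omega> q d \<and> square_integrable (lebesgue_on \<Omega>) d)}"

text \<open>Row \<open>i\<close> is the gradient of the \<open>i\<close>-th component.\<close>

definition weak_jacobian :: "(real^'n) set \<Rightarrow> (real^'n \<Rightarrow> real^'n) \<Rightarrow> real^'n \<Rightarrow> real^'n^'n" where
  "weak_jacobian \<Omega> v x = (\<chi> i. weak_grad \<Omega> (\<lambda>y. v y $ i) x)"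

definition strain :: "(real^'n) set \<Rightarrow> (real^'n \<Rightarrow> real^'n) \<Rightarrow> real^'n \<Rightarrow> real^'n^'n" where
  "strain \<Omega> v x = (1/2) *\<^sub>R (weak_jacobian \<Omega> v x + transpose (weak_jacobian \<Omega> v x))"

text \<open>The trace operator is the continuous extension to \<open>H1 \<Omega>\<close> of the restriction of smooth
  functions to the boundary.\<close>

definition is_trace :: "(real^'n) set \<Rightarrow> (real^'n \<Rightarrow> real) \<Rightarrow> (real^'n \<Rightarrow> real) \<Rightarrow> bool" where
  "is_trace \<Omega> f g \<longleftrightarrow> square_integrable (surface_on (frontier \<Omega>)) g \<and>
     (\<exists>\<Phi> :: nat \<Rightarrow> real^'n \<Rightarrow> real. (\<forall>m. \<Phi> m smooth_on UNIV) \<and>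
        (\<lambda>m. L2_norm (lebesgue_on \<Omega>) (\<lambda>x. \<Phi> m x - f x)) \<longlonglongrightarrow> 0 \<and>
        (\<lambda>m. L2_norm (lebesgue_on \<Omega>) (\<lambda>x. grad (\<Phi> m) x - weak_grad \<Omega> f x)) \<longlonglongrightarrow> 0 \<and>
        (\<lambda>m. L2_norm (surface_on (frontier \<Omega>)) (\<lambda>x. \<Phi> m x - g x)) \<longlonglongrightarrow> 0)"

definition trace_of :: "(real^'n) set \<Rightarrow> (real^'n \<Rightarrow> real) \<Rightarrow> real^'n \<Rightarrow> real" where
  "trace_of \<Omega> f = (SOME g. is_trace \<Omega> f g)"

definition vtrace :: "(real^'n) set \<Rightarrow> (real^'n \<Rightarrow> real^'n) \<Rightarrow> real^'n \<Rightarrow> real^'n" where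
  "vtrace \<Omega> v x = (\<chi> i. trace_of \<Omega> (\<lambda>y. v y $ i) x)"

text \<open>The normal component of a field in \<open>Hdiv \<Omega>\<close> on the boundary is given by Green's formula.\<close>

definition zero_normal_trace :: "(real^'n) set \<Rightarrow> (real^'n \<Rightarrow> real^'n) \<Rightarrow> bool" where
  "zero_normal_trace \<Omega> q \<longleftrightarrow> (\<forall>\<phi>. \<phi> smooth_on UNIV \<longrightarrow>
     L2_inner (lebesgue_on \<Omega>) q (grad \<phi>) + L2_inner (lebesgue_on \<Omega>) (weak_div \<Omega> q) \<phi> = 0)"


section \<open>Triangulations\<close>

text \<open>A domain with smooth boundary is not a union of straight simplices, so an element is the
  image of the reference simplex under a regular injective \<open>C\<^sup>1\<close> map; straight simplices
  are the case of an affine map.\<close>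

abbreviation ref_simplex :: "(real^'n) set" where
  "ref_simplex \<equiv> convex hull (insert 0 Basis)"

definition element_map :: "(real^'n \<Rightarrow> real^'n) \<Rightarrow> bool" where
  "element_map F \<longleftrightarrow> inj_on F ref_simplex \<and>
     (\<exists>U. open U \<and> ref_simplex \<subseteq> U \<and> Ck_on 1 F U \<and> (\<forall>x\<in>U. invertible (jacobian F (at x))))"

text \<open>Two elements meet in a common proper face, possibly empty.\<close>

definition conforming_triangulation :: "(real^'n) set \<Rightarrow> (real^'n) set set \<Rightarrow> bool" where
  "conforming_triangulation \<Omega> \<T> \<longleftrightarrow> finite \<T> \<and> \<Union>\<T> = closure \<Omega> \<and>
     (\<exists>F. (\<forall>T\<in>\<T>. element_map (F T) \<and> T = F T ` ref_simplex) \<and>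
        (\<forall>T\<in>\<T>. \<forall>T'\<in>\<T>. T \<noteq> T' \<longrightarrow>
           (\<exists>f f'. f face_of ref_simplex \<and> f \<noteq> ref_simplex \<and>
              f' face_of ref_simplex \<and> f' \<noteq> ref_simplex \<and>
              T \<inter> T' = F T ` f \<and> T \<inter> T' = F T' ` f')))"

text \<open>Shape regularity: the ratio of diameter to inradius is bounded over the whole family.\<close>

definition regular_family :: "(real^'n) set \<Rightarrow> (real^'n) set set set \<Rightarrow> bool" where
  "regular_family \<Omega> \<F> \<longleftrightarrow> (\<forall>\<T>\<in>\<F>. conforming_triangulation \<Omega> \<T>) \<and>
     (\<exists>\<kappa>. \<forall>\<T>\<in>\<F>. \<forall>T\<in>\<T>. \<exists>x r. 0 < r \<and> cball x r \<subseteq> T \<and> diameter T \<le> \<kappa> * r)"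


section \<open>Admissible displacements and discrete spaces\<close>

definition Vu :: "(real^'n) set \<Rightarrow> (real^'n) set \<Rightarrow> (real^'n) set \<Rightarrow> (real^'n \<Rightarrow> real) \<Rightarrow>
    (real^'n \<Rightarrow> real^'n) set" where
  "Vu \<Omega> \<Gamma>1 \<Gamma>3 ga = {v \<in> H1_vec \<Omega>.
     (AE x in surface_on \<Gamma>1. vtrace \<Omega> v x = 0) \<and>
     (AE x in surface_on \<Gamma>3. vtrace \<Omega> v x \<bullet> outward_normal \<Omega> x \<le> ga x)}"

definition piecewise_P1 :: "(real^'n) set set \<Rightarrow> (real^'n \<Rightarrow> real^'n) \<Rightarrow> bool" where
  "piecewise_P1 \<T> v \<longleftrightarrow> (\<forall>T\<in>\<T>. \<exists>A b. AE x in lebesgue_on T. v x = A *v x + b)"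

definition Vh :: "(real^'n) set \<Rightarrow> (real^'n) set \<Rightarrow> (real^'n) set \<Rightarrow> (real^'n \<Rightarrow> real) \<Rightarrow>
    (real^'n) set set \<Rightarrow> (real^'n \<Rightarrow> real^'n) set" where
  "Vh \<Omega> \<Gamma>1 \<Gamma>3 ga \<T> = {v \<in> Vu \<Omega> \<Gamma>1 \<Gamma>3 ga. piecewise_P1 \<T> v}"

text \<open>A piecewise constant function has no \<open>H1\<close> trace; its value on \<open>\<Gamma> \<inter> T\<close> is the constant
  on the element \<open>T\<close>, and it has to vanish wherever \<open>\<Gamma> \<inter> T\<close> has positive surface measure.\<close>

definition Qh :: "(real^'n) set \<Rightarrow> (real^'n) set set \<Rightarrow> (real^'n \<Rightarrow> real) set" where
  "Qh \<Omega> \<T> = {p. square_integrable (lebesgue_on \<Omega>) p \<and>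
     (\<forall>T\<in>\<T>. \<exists>c. (AE x in lebesgue_on T. p x = c) \<and>
        (emeasure surface_measure (frontier \<Omega> \<inter> T) > 0 \<longrightarrow> c = 0))}"

definition Zh :: "(real^'n) set \<Rightarrow> (real^'n) set set \<Rightarrow> (real^'n \<Rightarrow> real^'n) set" where
  "Zh \<Omega> \<T> = {q \<in> Hdiv \<Omega>. piecewise_P1 \<T> q \<and> zero_normal_trace \<Omega> q}"


section \<open>Permeability and iteration increments\<close>

definition permeability_tensor :: "(real^'n) set \<Rightarrow> (real^'n \<Rightarrow> real^'n^'n) \<Rightarrow> bool" where
  "permeability_tensor \<Omega> K \<longleftrightarrow> K \<in> borel_measurable (lebesgue_on \<Omega>) \<and>
     (\<forall>x\<in>\<Omega>. transpose (K x) = K x) \<and>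
     (\<exists>C. \<forall>x\<in>\<Omega>. norm (K x) \<le> C) \<and>
     (\<exists>c>0. \<forall>x\<in>\<Omega>. \<forall>\<xi>. c * (\<xi> \<bullet> \<xi>) \<le> \<xi> \<bullet> (K x *v \<xi>))"

text \<open>The symmetric positive semidefinite square root, which is unique.\<close>

definition matrix_sqrt :: "real^'n^'n \<Rightarrow> real^'n^'n" where
  "matrix_sqrt A = (SOME S. transpose S = S \<and> (\<forall>\<xi>. 0 \<le> \<xi> \<bullet> (S *v \<xi>)) \<and> S ** S = A)"

definition increment :: "(nat \<Rightarrow> 'a \<Rightarrow> 'b::minus) \<Rightarrow> nat \<Rightarrow> 'a \<Rightarrow> 'b" where
  "increment w n x = w n x - w (n - 1) x"

end

theory Submission
  imports Defs
begin

text \<open>The contraction is an energy estimate for the differences of consecutive iterates.  Write \<open>\<delta>p\<close>, \<open>\<delta>z\<close>,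
\<open>\<delta>u\<close> for the new increments, \<open>\<delta>\<sigma>\<close> for the old stress increment and \<open>\<delta>\<sigma>'\<close> for the new one.
Subtract the mass balances of two consecutive iterations and test with \<open>\<delta>p\<close>, subtract the two Darcy laws
and test with \<open>\<delta>z\<close>, and insert one into the other:
\<open>\<alpha>\<^sup>2 \<beta> \<parallel>\<delta>p\<parallel>\<^sup>2 + (dt / \<mu>f) (K\<^sup>-\<^sup>1 \<delta>z, \<delta>z) = - (\<alpha> / lam) (\<delta>\<sigma>, \<delta>p)\<close>.
Each variational inequality admits the iterate of the other one as test function, and their sum is
\<open>2 G \<parallel>\<epsilon>(\<delta>u)\<parallel>\<^sup>2 + lam \<parallel>div \<delta>u\<parallel>\<^sup>2 \<le> \<alpha> (\<delta>p, div \<delta>u)\<close>; the contact condition needs no other treatment.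
The expansion of \<open>\<parallel>\<delta>\<sigma>'\<parallel>\<^sup>2 = \<parallel>lam div \<delta>u - \<alpha> \<delta>p\<parallel>\<^sup>2\<close> and Young's inequality for \<open>(\<delta>\<sigma>, \<delta>p)\<close> then give the
claim (\<open>fixed_stress_algebra\<close>).

The differences of weak divergences and strains that occur here are those of representatives picked by
choice.  That these representatives are linear almost everywhere rests on the uniqueness of weak
derivatives, hence on the fundamental lemma of the calculus of variations (\<open>du_bois_reymond\<close>), which is
proved with explicit smooth bump functions.  The norm of \<open>K\<^sup>-\<^sup>1\<^sup>/\<^sup>2 \<delta>z\<close> involves a matrix
square root picked by choice as well; its existence (\<open>symmetric_matrix_sqrt_exists\<close>) is obtained from
Brouwer's fixed point theorem.\<close>

section \<open>Smooth bump functions and the fundamental lemma of the calculus of variations\<close>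

lemma Ck_on_UNIV_Suc_imp:
  fixes f :: "real^'n \<Rightarrow> real"
  shows "Ck_on (Suc k) f UNIV \<Longrightarrow> Ck_on k f UNIV"
proof (induction k arbitrary: f)
  case 0
  then show ?case
    by (auto intro!: continuous_at_imp_continuous_on differentiable_imp_continuous_within)
next
  case (Suc k)
  show ?case
    using Suc.prems Suc.IH[of "\<lambda>x. frechet_derivative f (at x) (axis i 1)" for i]
    by (subst Ck_on.simps(2)) (subst (asm) Ck_on.simps(2), blast)
qed

lemma Ck_on_UNIV_const: "Ck_on k (\<lambda>x::real^'n. c::real) UNIV"
  by (induction k arbitrary: c) (auto simp: frechet_derivative_const)

lemma Ck_on_UNIV_add:
  fixes f g :: "real^'n \<Rightarrow> real"
  shows "Ck_on k f UNIV \<Longrightarrow> Ck_on k g UNIV \<Longrightarrow> Ck_on k (\<lambda>x. f x + g x) UNIV"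
proof (induction k arbitrary: f g)
  case (Suc k)
  then have f: "f differentiable (at x)" and g: "g differentiable (at x)" for x
    by auto
  have "frechet_derivative (\<lambda>x. f x + g x) (at x)
      = (\<lambda>h. frechet_derivative f (at x) h + frechet_derivative g (at x) h)" for x
    by (intro frechet_derivative_at[symmetric] has_derivative_add)
       (use f g in \<open>auto simp: frechet_derivative_works[symmetric]\<close>)
  then show ?case
    using Suc f g by auto
qed (simp add: continuous_on_add)

lemma Ck_on_UNIV_mult:
  fixes f g :: "real^'n \<Rightarrow> real"
  shows "Ck_on k f UNIV \<Longrightarrow> Ck_on k g UNIV \<Longrightarrow> Ck_on k (\<lambda>x. f x * g x) UNIV"
proof (induction k arbitrary: f g)
  case (Suc k)
  then have f: "f differentiable (at x)" and g: "g differentiable (at x)" for x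
    by auto
  have *: "frechet_derivative (\<lambda>x. f x * g x) (at x)
      = (\<lambda>h. f x * frechet_derivative g (at x) h + frechet_derivative f (at x) h * g x)" for x
    by (intro frechet_derivative_at[symmetric] has_derivative_mult)
       (use f g in \<open>auto simp: frechet_derivative_works[symmetric]\<close>)
  have "Ck_on k f UNIV" "Ck_on k g UNIV"
    using Suc.prems Ck_on_UNIV_Suc_imp by blast+
  then show ?case
    using Suc f g by (auto simp: * intro!: Ck_on_UNIV_add)
qed (simp add: continuous_on_mult)

lemma Ck_on_UNIV_prod:
  fixes f :: "'i \<Rightarrow> real^'n \<Rightarrow> real"
  assumes "\<And>i. i \<in> I \<Longrightarrow> Ck_on k (f i) UNIV"
  shows "Ck_on k (\<lambda>x. \<Prod>i\<in>I. f i x) UNIV"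
  using assms
proof (induction I rule: infinite_finite_induct)
  case (insert i I)
  then show ?case
    by (auto intro!: Ck_on_UNIV_mult)
qed (auto intro: Ck_on_UNIV_const)

text \<open>The functions \<open>p (1 / t) * exp (- 1 / t)\<close>, extended by \<open>0\<close> to \<open>t \<le> 0\<close>.  The family over all
polynomials \<open>p\<close> is closed under differentiation, which makes every member smooth.\<close>

definition flat_exp :: "real poly \<Rightarrow> real \<Rightarrow> real" where
  "flat_exp p t = (if t > 0 then poly p (1 / t) * exp (- (1 / t)) else 0)"

lemma poly_times_exp_minus_tendsto_0:
  "((\<lambda>s::real. poly p s * exp (- s)) \<longlongrightarrow> 0) at_top"
proof -
  have "((\<lambda>s::real. s ^ k * poly p s / exp s) \<longlongrightarrow> 0) at_top" for k
  proof (induction p arbitrary: k)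
    case (pCons a p)
    have "((\<lambda>s::real. a * (s ^ k / exp s) + s ^ Suc k * poly p s / exp s) \<longlongrightarrow> a * 0 + 0) at_top"
      by (intro tendsto_intros pCons.IH tendsto_power_div_exp_0)
    then show ?case
      by (simp add: field_simps)
  qed auto
  from this[of 0] show ?thesis
    by (simp add: exp_minus field_simps)
qed

lemma flat_exp_has_real_derivative:
  "(flat_exp p has_real_derivative flat_exp ([:0, 0, 1:] * (p - pderiv p)) t) (at t)"
proof (cases t "0::real" rule: linorder_cases)
  case less
  have "((\<lambda>_. 0) has_real_derivative 0) (at t)"
    by simp
  moreover have "\<forall>\<^sub>F s in nhds t. flat_exp p s = 0"
    using eventually_nhds_in_open[of "{..<0::real}" t] less
    by (auto elim!: eventually_mono simp: flat_exp_def)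
  ultimately show ?thesis
    using less by (subst DERIV_cong_ev[OF refl _ refl]) (auto simp: flat_exp_def)
next
  case greater
  have "((\<lambda>t. poly p (1 / t) * exp (- (1 / t))) has_real_derivative
      flat_exp ([:0, 0, 1:] * (p - pderiv p)) t) (at t)"
    using greater
    by (auto intro!: derivative_eq_intros poly_DERIV[THEN DERIV_chain2] simp: flat_exp_def field_simps power2_eq_square)
  moreover have "\<forall>\<^sub>F s in nhds t. flat_exp p s = poly p (1 / s) * exp (- (1 / s))"
    using eventually_nhds_in_open[of "{0<..}" t] greater
    by (auto elim!: eventually_mono simp: flat_exp_def)
  ultimately show ?thesis
    using DERIV_cong_ev by fastforce
next
  case equal
  have "((\<lambda>h. flat_exp p h / h) \<longlongrightarrow> 0) (at_right 0)"
  proof (rule Lim_transform_eventually)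
    show "((\<lambda>h::real. poly ([:0, 1:] * p) (inverse h) * exp (- inverse h)) \<longlongrightarrow> 0) (at_right 0)"
      by (rule filterlim_compose[OF poly_times_exp_minus_tendsto_0 filterlim_inverse_at_top_right])
    show "\<forall>\<^sub>F h in at_right 0. poly ([:0, 1:] * p) (inverse h) * exp (- inverse h) = flat_exp p h / h"
      by (auto simp: eventually_at_filter flat_exp_def field_simps)
  qed
  moreover have "((\<lambda>h. flat_exp p h / h) \<longlongrightarrow> 0) (at_left 0)"
    by (rule Lim_transform_eventually[of "\<lambda>_. 0"]) (auto simp: eventually_at_filter flat_exp_def)
  ultimately have "((\<lambda>h. flat_exp p h / h) \<longlongrightarrow> 0) (at 0)"
    by (simp add: filterlim_at_split)
  then show ?thesis
    unfolding equal by (simp add: has_field_derivative_iff flat_exp_def)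
qed

text \<open>By induction on \<open>k\<close> with \<open>p\<close> varying: each partial derivative is again a constant multiple
of a function of the same form.\<close>

lemma Ck_on_UNIV_flat_exp_component:
  "Ck_on k (\<lambda>x::real^'n. flat_exp p (a * x $ i + c)) UNIV"
proof (induction k arbitrary: p)
  case 0
  have "isCont (flat_exp p) t" for t
    using flat_exp_has_real_derivative DERIV_isCont by blast
  then show ?case
    by (simp add: continuous_on_compose2[of UNIV "flat_exp p"] continuous_at_imp_continuous_on
        continuous_on_add continuous_on_mult continuous_on_component)
next
  case (Suc k)
  let ?q = "[:0, 0, 1:] * (p - pderiv p)"
  have D: "((\<lambda>x::real^'n. flat_exp p (a * x $ i + c)) has_derivative
      (\<lambda>h. (a * h $ i) * flat_exp ?q (a * x $ i + c))) (at x)" for x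
  proof (rule DERIV_compose_FDERIV[OF flat_exp_has_real_derivative])
    show "((\<lambda>x::real^'n. a * x $ i + c) has_derivative (\<lambda>h. a * h $ i)) (at x)"
      by (rule has_derivative_add_const[OF has_derivative_mult_right[OF
            bounded_linear_imp_has_derivative[OF bounded_linear_vec_nth]]])
  qed
  have "frechet_derivative (\<lambda>x::real^'n. flat_exp p (a * x $ i + c)) (at x)
      = (\<lambda>h. (a * h $ i) * flat_exp ?q (a * x $ i + c))" for x
    using frechet_derivative_at[OF D] by simp
  moreover have "(\<lambda>x::real^'n. flat_exp p (a * x $ i + c)) differentiable (at x)" for x
    using D unfolding differentiable_def by blast
  moreover have "Ck_on k (\<lambda>x::real^'n. (a * axis j 1 $ i) * flat_exp ?q (a * x $ i + c)) UNIV" for j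
    by (rule Ck_on_UNIV_mult[OF Ck_on_UNIV_const Suc.IH])
  ultimately show ?case
    by simp
qed

text \<open>A smooth function that is positive exactly on the open box \<open>box a b\<close>; the scaling by \<open>m + 1\<close>
makes the functions increase to the indicator of the box.\<close>

definition box_bump :: "real^'n \<Rightarrow> real^'n \<Rightarrow> nat \<Rightarrow> real^'n \<Rightarrow> real" where
  "box_bump a b m x = (\<Prod>i\<in>UNIV. flat_exp 1 (real (Suc m) * (x $ i - a $ i)) *
     flat_exp 1 (real (Suc m) * (b $ i - x $ i)))"

lemma box_bump_smooth: "box_bump a b m smooth_on UNIV"
proof -
  have "Ck_on k (\<lambda>x. \<Prod>i\<in>UNIV. flat_exp 1 (real (Suc m) * x $ i + - real (Suc m) * a $ i) *
     flat_exp 1 (- real (Suc m) * x $ i + real (Suc m) * b $ i)) UNIV" for k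
    by (intro Ck_on_UNIV_prod Ck_on_UNIV_mult Ck_on_UNIV_flat_exp_component)
  moreover have "box_bump a b m = (\<lambda>x. \<Prod>i\<in>UNIV. flat_exp 1 (real (Suc m) * x $ i + - real (Suc m) * a $ i) *
     flat_exp 1 (- real (Suc m) * x $ i + real (Suc m) * b $ i))"
    by (simp add: box_bump_def fun_eq_iff algebra_simps)
  ultimately show ?thesis
    by (simp add: smooth_on_def)
qed

lemma box_bump_outside: "x \<notin> box a b \<Longrightarrow> box_bump a b m x = 0"
  by (auto simp: box_bump_def mem_box_cart flat_exp_def zero_less_mult_iff intro!: prod_zero)

lemma flat_exp_1_bounds: "0 \<le> flat_exp 1 t" "flat_exp 1 t \<le> 1"
  by (auto simp: flat_exp_def)

lemma box_bump_bounds: "0 \<le> box_bump a b m x" "box_bump a b m x \<le> 1"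
  by (auto simp: box_bump_def flat_exp_1_bounds intro!: prod_nonneg prod_le_1 mult_le_one)

lemma box_bump_tendsto: "(\<lambda>m. box_bump a b m x) \<longlonglongrightarrow> indicator (box a b) x"
proof (cases "x \<in> box a b")
  case True
  have flat: "(\<lambda>m. flat_exp 1 (real (Suc m) * t)) \<longlonglongrightarrow> 1" if "t > 0" for t
  proof -
    have "(\<lambda>m. exp (- (inverse (real (Suc m)) * (1 / t)))) \<longlonglongrightarrow> exp (- (0 * (1 / t)))"
      by (intro tendsto_intros LIMSEQ_inverse_real_of_nat)
    moreover have "flat_exp 1 (real (Suc m) * t) = exp (- (inverse (real (Suc m)) * (1 / t)))" for m
      using that by (simp add: flat_exp_def zero_less_mult_iff divide_simps)
    ultimately show ?thesis
      by simp
  qed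
  have "(\<lambda>m. box_bump a b m x) \<longlonglongrightarrow> (\<Prod>i\<in>(UNIV::'a set). 1 * 1)"
    unfolding box_bump_def using True
    by (intro tendsto_prod tendsto_mult flat) (auto simp: mem_box_cart)
  then show ?thesis
    using True by simp
qed (simp add: box_bump_outside)

lemma box_bump_test_function:
  assumes "cbox a b \<subseteq> \<Omega>"
  shows "box_bump a b m \<in> test_functions \<Omega>"
proof -
  have "{x. box_bump a b m x \<noteq> 0} \<subseteq> cbox a b"
    using box_bump_outside box_subset_cbox by fastforce
  then have "closure {x. box_bump a b m x \<noteq> 0} \<subseteq> cbox a b"
    by (simp add: closed_cbox closure_minimal)
  then show ?thesis
    using assms box_bump_smooth closed_cbox[of a b] bounded_subset[OF bounded_cbox[of a b]]
    by (auto simp: test_functions_def compact_eq_bounded_closed)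
qed

text \<open>Box bumps are test functions, and they converge boundedly to the indicator of the box, so
dominated convergence passes orthogonality on to the indicator.\<close>

lemma integral_cbox_eq_0_if_orthogonal:
  fixes f :: "real^'n \<Rightarrow> real"
  assumes f: "f locally_integrable_on \<Omega>"
    and orth: "\<And>\<phi>. \<phi> \<in> test_functions \<Omega> \<Longrightarrow> (LINT x|lebesgue_on \<Omega>. f x * \<phi> x) = 0"
    and \<Omega>: "open \<Omega>" and sub: "cbox a b \<subseteq> \<Omega>"
  shows "integral (cbox a b) f = 0"
proof -
  define F where "F = (\<lambda>x. indicator (cbox a b) x *\<^sub>R f x)"
  have fab: "f absolutely_integrable_on cbox a b"
    using f sub by (simp add: locally_integrable_on_def)
  then have F: "integrable lebesgue F"
    by (simp add: set_integrable_def F_def)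
  have zero: "(LINT x|lebesgue. F x * box_bump a b m x) = 0" for m
  proof -
    \<comment> \<open>Both integrands vanish outside the box, which lies in \<open>\<Omega>\<close>.\<close>
    have "(LINT x|lebesgue. F x * box_bump a b m x)
        = (LINT x|lebesgue. indicator \<Omega> x *\<^sub>R (f x * box_bump a b m x))"
      using sub box_subset_cbox[of a b] box_bump_outside[of _ a b m]
      by (intro Bochner_Integration.integral_cong) (auto simp: F_def indicator_def)
    also have "\<dots> = (LINT x|lebesgue_on \<Omega>. f x * box_bump a b m x)"
      using \<Omega> by (subst integral_restrict_space) auto
    finally show ?thesis
      using orth[OF box_bump_test_function[OF sub]] by simp
  qed
  have bump_meas: "box_bump a b m \<in> borel_measurable lebesgue" for m
  proof -
    have "continuous_on UNIV (box_bump a b m)"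
      using box_bump_smooth[of a b m] by (auto simp: smooth_on_def dest: spec[of _ 0])
    then show ?thesis
      by (intro measurable_completion) (simp add: borel_measurable_continuous_onI)
  qed
  have "(\<lambda>m. LINT x|lebesgue. F x * box_bump a b m x)
      \<longlonglongrightarrow> (LINT x|lebesgue. F x * indicator (box a b) x)"
  proof (rule integral_dominated_convergence)
    show "integrable lebesgue (\<lambda>x. norm (F x))"
      using F by simp
    show "AE x in lebesgue. (\<lambda>m. F x * box_bump a b m x) \<longlonglongrightarrow> F x * indicator (box a b) x"
      by (intro AE_I2 tendsto_mult tendsto_const box_bump_tendsto)
    show "AE x in lebesgue. norm (F x * box_bump a b m x) \<le> norm (F x)" for m
      by (intro AE_I2) (simp add: abs_mult box_bump_bounds mult_left_le)
    show "(\<lambda>x. F x * indicator (box a b) x) \<in> borel_measurable lebesgue"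
      using F by (intro borel_measurable_times borel_measurable_indicator) auto
    show "(\<lambda>x. F x * box_bump a b m x) \<in> borel_measurable lebesgue" for m
      using F bump_meas by (intro borel_measurable_times) auto
  qed
  then have "(LINT x|lebesgue. F x * indicator (box a b) x) = 0"
    by (simp add: zero LIMSEQ_const_iff)
  moreover have "F x * indicator (box a b) x = indicator (box a b) x *\<^sub>R f x" for x
    using box_subset_cbox[of a b] by (auto simp: F_def indicator_def)
  ultimately have "(LINT x:box a b|lebesgue. f x) = 0"
    by (simp add: set_lebesgue_integral_def)
  moreover have "f absolutely_integrable_on box a b"
    by (rule set_integrable_subset[OF fab]) (auto simp: box_subset_cbox)
  ultimately have "integral (box a b) f = 0"
    using set_lebesgue_integral_eq_integral(2)[of "box a b" f] by simp
  then show ?thesis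
    by (simp add: integral_open_interval)
qed

text \<open>The fundamental lemma of the calculus of variations.  All integrals over boxes vanish, and almost
every value of \<open>f\<close> is a limit of averages over small boxes.\<close>

lemma du_bois_reymond:
  fixes f :: "real^'n \<Rightarrow> real"
  assumes f: "f locally_integrable_on \<Omega>"
    and orth: "\<And>\<phi>. \<phi> \<in> test_functions \<Omega> \<Longrightarrow> (LINT x|lebesgue_on \<Omega>. f x * \<phi> x) = 0"
    and \<Omega>: "open \<Omega>"
  shows "AE x in lebesgue_on \<Omega>. f x = 0"
proof -
  have box: "AE x in lebesgue. x \<in> cbox a b \<longrightarrow> f x = 0" if sub: "cbox a b \<subseteq> \<Omega>" for a b
  proof -
    define F where "F = (\<lambda>x. if x \<in> cbox a b then f x else 0)"
    have "f integrable_on cbox a b"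
      using f sub absolutely_integrable_on_def locally_integrable_on_def
      by (metis compact_cbox)
    then have "F integrable_on UNIV"
      unfolding F_def using integrable_restrict_UNIV by blast
    then have "F integrable_on cbox c d" for c d
      using integrable_on_subcbox by blast
    then obtain N where "negligible N" and N: "\<And>x e. \<lbrakk>x \<notin> N; 0 < e\<rbrakk> \<Longrightarrow>
        \<exists>d>0. \<forall>h. 0 < h \<and> h < d \<longrightarrow>
           norm (integral (cbox x (x + h *\<^sub>R One)) F /\<^sub>R h ^ DIM(real^'n) - F x) < e"
      using integrable_ccontinuous_explicit by blast
    have "f x = 0" if x: "x \<in> box a b" "x \<notin> N" for x
    proof (rule ccontr)
      assume "f x \<noteq> 0"
      then have "norm (f x) > 0"
        by simp
      then obtain d where "d > 0" and d: "\<And>h. 0 < h \<Longrightarrow> h < d \<Longrightarrow>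
          norm (integral (cbox x (x + h *\<^sub>R One)) F /\<^sub>R h ^ DIM(real^'n) - F x) < norm (f x)"
        using N[OF x(2)] by blast
      have "((\<lambda>h. x + h *\<^sub>R (One::real^'n)) \<longlongrightarrow> x + 0 *\<^sub>R One) (at_right 0)"
        by (intro tendsto_intros)
      then have "\<forall>\<^sub>F h in at_right 0. x + h *\<^sub>R (One::real^'n) \<in> box a b"
        using x(1) topological_tendstoD[OF _ open_box] by fastforce
      moreover have "\<forall>\<^sub>F h in at_right (0::real). 0 < h \<and> h < d"
        using \<open>d > 0\<close> eventually_at_right_less[of 0] eventually_at_right by (auto intro!: eventually_conj)
      ultimately have "\<forall>\<^sub>F h in at_right (0::real). 0 < h \<and> h < d \<and> x + h *\<^sub>R (One::real^'n) \<in> box a b"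
        by eventually_elim auto
      then obtain h where h: "0 < h" "h < d" "x + h *\<^sub>R (One::real^'n) \<in> box a b"
        using eventually_happens'[OF trivial_limit_at_right_real] by blast
      then have cb: "cbox x (x + h *\<^sub>R One) \<subseteq> cbox a b"
        using x(1) by (force simp: subset_box(1) mem_box dest: less_imp_le)
      then have "integral (cbox x (x + h *\<^sub>R One)) F = integral (cbox x (x + h *\<^sub>R One)) f"
        by (intro integral_cong) (auto simp: F_def)
      also have "\<dots> = 0"
        using integral_cbox_eq_0_if_orthogonal[OF f orth \<Omega>] cb sub by auto
      finally have "norm (F x) < norm (f x)"
        using d[OF h(1,2)] by simp
      then show False
        using x(1) box_subset_cbox by (auto simp: F_def split: if_splits)
    qed
    moreover have "negligible (N \<union> (cbox a b - box a b))"
      using \<open>negligible N\<close> negligible_frontier_interval negligible_Un by blast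
    ultimately show ?thesis
      unfolding eventually_ae_filter_negligible by (intro exI[of _ "N \<union> (cbox a b - box a b)"]) auto
  qed
  \<comment> \<open>Countably many boxes cover \<open>\<Omega>\<close>.\<close>
  obtain \<D> where \<D>: "countable \<D>" "\<D> \<subseteq> Pow \<Omega>" "\<And>X. X \<in> \<D> \<Longrightarrow> \<exists>a b. X = cbox a b" "\<Union>\<D> = \<Omega>"
    using open_countable_Union_open_cbox[OF \<Omega>] by metis
  have "AE x in lebesgue. \<forall>X\<in>\<D>. x \<in> X \<longrightarrow> f x = 0"
    using \<D>(1)
  proof (subst AE_ball_countable, safe)
    fix X assume "X \<in> \<D>"
    then show "AE x in lebesgue. x \<in> X \<longrightarrow> f x = 0"
      using \<D>(2,3) box by (metis PowD subsetD)
  qed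
  then have "AE x in lebesgue. x \<in> \<Omega> \<longrightarrow> f x = 0"
    by eventually_elim (use \<D>(4) in auto)
  then show ?thesis
    using \<Omega> by (subst AE_restrict_space_iff) auto
qed

section \<open>Square-integrable fields\<close>

lemma integrable_inner_if_square_integrable:
  assumes "square_integrable M f" "square_integrable M g"
  shows "integrable M (\<lambda>x. f x \<bullet> g x)"
proof (rule Bochner_Integration.integrable_bound)
  show "integrable M (\<lambda>x. (norm (f x))\<^sup>2 + (norm (g x))\<^sup>2)"
    using assms by (simp add: square_integrable_def)
  show "(\<lambda>x. f x \<bullet> g x) \<in> borel_measurable M"
    using assms by (auto simp: square_integrable_def)
  have "norm (f x \<bullet> g x) \<le> norm ((norm (f x))\<^sup>2 + (norm (g x))\<^sup>2)" for x
    using Cauchy_Schwarz_ineq2[of "f x" "g x"] sum_squares_bound[of "norm (f x)" "norm (g x)"]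
      zero_le_power2[of "norm (f x)"] zero_le_power2[of "norm (g x)"]
      mult_nonneg_nonneg[of "norm (f x)" "norm (g x)"]
    by simp
  then show "AE x in M. norm (f x \<bullet> g x) \<le> norm ((norm (f x))\<^sup>2 + (norm (g x))\<^sup>2)"
    by simp
qed

lemma square_integrable_bound:
  assumes "square_integrable M f" "g \<in> borel_measurable M"
    and "\<And>x. x \<in> space M \<Longrightarrow> norm (g x) \<le> c * norm (f x)"
  shows "square_integrable M g"
proof -
  have "integrable M (\<lambda>x. (norm (g x))\<^sup>2)"
  proof (rule Bochner_Integration.integrable_bound)
    show "integrable M (\<lambda>x. c\<^sup>2 * (norm (f x))\<^sup>2)"
      using assms by (simp add: square_integrable_def)
    show "AE x in M. norm ((norm (g x))\<^sup>2) \<le> norm (c\<^sup>2 * (norm (f x))\<^sup>2)"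
    proof (rule AE_I2)
      fix x assume "x \<in> space M"
      then have "(norm (g x))\<^sup>2 \<le> (c * norm (f x))\<^sup>2"
        by (intro power_mono assms) auto
      then show "norm ((norm (g x))\<^sup>2) \<le> norm (c\<^sup>2 * (norm (f x))\<^sup>2)"
        by (simp add: power_mult_distrib)
    qed
  qed (use assms in simp)
  then show ?thesis
    using assms by (simp add: square_integrable_def)
qed

lemma square_integrable_cong_AE:
  assumes "square_integrable M f" "g \<in> borel_measurable M" "AE x in M. g x = f x"
  shows "square_integrable M g"
proof -
  have "integrable M (\<lambda>x. (norm (g x))\<^sup>2)"
  proof (rule integrable_cong_AE_imp)
    show "integrable M (\<lambda>x. (norm (f x))\<^sup>2)"
      using assms by (simp add: square_integrable_def)
    show "AE x in M. (norm (f x))\<^sup>2 = (norm (g x))\<^sup>2"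
      using assms(3) by eventually_elim simp
  qed (use assms in simp)
  then show ?thesis
    using assms by (simp add: square_integrable_def)
qed

lemma square_integrable_scaleR:
  "square_integrable M f \<Longrightarrow> square_integrable M (\<lambda>x. c *\<^sub>R f x)"
  by (auto simp: square_integrable_def power_mult_distrib)

lemma square_integrable_add:
  assumes "square_integrable M f" "square_integrable M g"
  shows "square_integrable M (\<lambda>x. f x + g x)"
proof -
  have "(norm (f x + g x))\<^sup>2 = (norm (f x))\<^sup>2 + 2 * (f x \<bullet> g x) + (norm (g x))\<^sup>2" for x
    by (simp add: power2_norm_eq_inner algebra_simps inner_commute)
  then show ?thesis
    using assms integrable_inner_if_square_integrable[OF assms]
    by (auto simp: square_integrable_def)
qed

lemma square_integrable_diff:
  assumes "square_integrable M f" "square_integrable M g"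
  shows "square_integrable M (\<lambda>x. f x - g x)"
  using square_integrable_add[OF assms(1) square_integrable_scaleR[OF assms(2), of "-1"]]
  by (simp add: scaleR_minus1_left)

lemma square_integrable_sum:
  assumes "\<And>i. i \<in> I \<Longrightarrow> square_integrable M (f i)"
  shows "square_integrable M (\<lambda>x. \<Sum>i\<in>I. f i x)"
  using assms
proof (induction I rule: infinite_finite_induct)
  case (insert i I)
  then show ?case
    by (simp add: square_integrable_add)
qed (simp_all add: square_integrable_def)

lemma L2_inner_commute: "L2_inner M f g = L2_inner M g f"
  by (simp add: L2_inner_def inner_commute)

lemma L2_inner_diff_left:
  assumes "square_integrable M f" "square_integrable M g" "square_integrable M h"
  shows "L2_inner M (\<lambda>x. f x - g x) h = L2_inner M f h - L2_inner M g h"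
  using assms by (simp add: L2_inner_def inner_diff_left integrable_inner_if_square_integrable)

lemma L2_inner_diff_right:
  assumes "square_integrable M f" "square_integrable M g" "square_integrable M h"
  shows "L2_inner M h (\<lambda>x. f x - g x) = L2_inner M h f - L2_inner M h g"
  using L2_inner_diff_left[OF assms] by (simp add: L2_inner_commute)

lemma L2_inner_scaleR_left: "L2_inner M (\<lambda>x. c *\<^sub>R f x) g = c * L2_inner M f g"
  by (simp add: L2_inner_def)

lemma L2_inner_scaleR_right: "L2_inner M f (\<lambda>x. c *\<^sub>R g x) = c * L2_inner M f g"
  by (simp add: L2_inner_def)

lemma L2_inner_mult_left:
  fixes f g :: "'a \<Rightarrow> real"
  shows "L2_inner M (\<lambda>x. c * f x) g = c * L2_inner M f g"
  using L2_inner_scaleR_left[of M c f g] by simp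

lemma L2_inner_mult_right:
  fixes f g :: "'a \<Rightarrow> real"
  shows "L2_inner M f (\<lambda>x. c * g x) = c * L2_inner M f g"
  using L2_inner_scaleR_right[of M f c g] by simp

lemma L2_inner_cong_AE:
  assumes "f \<in> borel_measurable M" "f' \<in> borel_measurable M"
    and "g \<in> borel_measurable M" "g' \<in> borel_measurable M"
    and "AE x in M. f x = f' x" "AE x in M. g x = g' x"
  shows "L2_inner M f g = L2_inner M f' g'"
  unfolding L2_inner_def
proof (rule integral_cong_AE)
  show "AE x in M. f x \<bullet> g x = f' x \<bullet> g' x"
    using assms(5,6) by eventually_elim simp
qed (use assms in auto)

lemma L2_inner_self_nonneg: "0 \<le> L2_inner M f f"
  by (simp add: L2_inner_def)

lemma L2_norm_power2: "(L2_norm M f)\<^sup>2 = L2_inner M f f"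
  by (simp add: L2_norm_def L2_inner_self_nonneg)

text \<open>No integrability is needed here, because negation commutes with the integral unconditionally.\<close>

lemma L2_inner_diff_swap: "L2_inner M f (\<lambda>x. g x - h x) = - L2_inner M f (\<lambda>x. h x - g x)"
proof -
  have "L2_inner M f (\<lambda>x. g x - h x) = (LINT x|M. - (f x \<bullet> (h x - g x)))"
    by (simp add: L2_inner_def inner_diff_right)
  then show ?thesis
    by (simp add: L2_inner_def)
qed

lemma L2_inner_lincomb_self:
  fixes f g :: "'a \<Rightarrow> real"
  assumes f: "square_integrable M f" and g: "square_integrable M g"
  shows "L2_inner M (\<lambda>x. a * f x - b * g x) (\<lambda>x. a * f x - b * g x)
    = a\<^sup>2 * L2_inner M f f - 2 * a * b * L2_inner M f g + b\<^sup>2 * L2_inner M g g"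
proof -
  have af: "square_integrable M (\<lambda>x. a * f x)" and bg: "square_integrable M (\<lambda>x. b * g x)"
    using square_integrable_scaleR[OF f, of a] square_integrable_scaleR[OF g, of b] by simp_all
  show ?thesis
    unfolding L2_inner_diff_left[OF af bg square_integrable_diff[OF af bg]]
      L2_inner_mult_left L2_inner_diff_right[OF af bg f] L2_inner_diff_right[OF af bg g]
      L2_inner_mult_right
    by (simp add: L2_inner_commute[of M g f] power2_eq_square algebra_simps)
qed

lemma borel_measurable_vec_nth:
  fixes f :: "'a \<Rightarrow> 'b::euclidean_space^'n"
  shows "f \<in> borel_measurable M \<Longrightarrow> (\<lambda>x. f x $ i) \<in> borel_measurable M"
  by (rule measurable_compose[of f M borel])
     (auto intro!: borel_measurable_continuous_onI continuous_on_component)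

lemma borel_measurable_vecI:
  fixes f :: "'a \<Rightarrow> 'b::euclidean_space^'n"
  assumes "\<And>i. (\<lambda>x. f x $ i) \<in> borel_measurable M"
  shows "f \<in> borel_measurable M"
  unfolding borel_measurable_euclidean_space[of f]
proof
  fix b :: "'b^'n"
  assume "b \<in> Basis"
  then obtain i c where "b = axis i c"
    by (auto simp: Basis_vec_def)
  then show "(\<lambda>x. f x \<bullet> b) \<in> borel_measurable M"
    using assms[of i] by (simp add: inner_axis)
qed

lemma square_integrable_component:
  fixes f :: "'a \<Rightarrow> 'b::euclidean_space^'n"
  assumes "square_integrable M f"
  shows "square_integrable M (\<lambda>x. f x $ i)"
proof (rule square_integrable_bound[OF assms])
  show "(\<lambda>x. f x $ i) \<in> borel_measurable M"
    using assms by (intro borel_measurable_vec_nth) (simp add: square_integrable_def)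
  show "norm (f x $ i) \<le> 1 * norm (f x)" for x
    by (simp add: Finite_Cartesian_Product.norm_nth_le)
qed

lemma square_integrable_vecI:
  fixes f :: "'a \<Rightarrow> 'b::euclidean_space^'n"
  assumes "\<And>i. square_integrable M (\<lambda>x. f x $ i)"
  shows "square_integrable M f"
proof -
  have "(norm (f x))\<^sup>2 = (\<Sum>i\<in>UNIV. (norm (f x $ i))\<^sup>2)" for x
    by (simp add: norm_vec_def L2_set_def sum_nonneg)
  moreover have "integrable M (\<lambda>x. \<Sum>i\<in>UNIV. (norm (f x $ i))\<^sup>2)"
    using assms by (intro Bochner_Integration.integrable_sum) (simp add: square_integrable_def)
  moreover have "f \<in> borel_measurable M"
    using assms by (intro borel_measurable_vecI) (simp add: square_integrable_def)
  ultimately show ?thesis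
    by (simp add: square_integrable_def)
qed

lemma square_integrable_continuous:
  fixes f :: "'a::euclidean_space \<Rightarrow> 'b::euclidean_space"
  assumes f: "continuous_on UNIV f" and \<Omega>: "open \<Omega>" "bounded \<Omega>"
  shows "square_integrable (lebesgue_on \<Omega>) f"
proof -
  have "compact (f ` closure \<Omega>)"
    using \<Omega>(2) continuous_on_subset[OF f] by (intro compact_continuous_image) auto
  then obtain c where c: "\<And>x. x \<in> closure \<Omega> \<Longrightarrow> norm (f x) \<le> c"
    using compact_imp_bounded bounded_iff by (metis imageI)
  have "finite_measure (lebesgue_on \<Omega>)"
    using \<Omega> by (intro finite_measure_lebesgue_on lmeasurable_open)
  then have one: "square_integrable (lebesgue_on \<Omega>) (\<lambda>x. 1::real)"
    by (simp add: square_integrable_def finite_measure.integrable_const)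
  show ?thesis
  proof (rule square_integrable_bound[OF one])
    show "f \<in> borel_measurable (lebesgue_on \<Omega>)"
      using \<Omega>(1) continuous_on_subset[OF f] by (intro continuous_imp_measurable_on_sets_lebesgue) auto
    show "norm (f x) \<le> c * norm (1::real)" if "x \<in> space (lebesgue_on \<Omega>)" for x
      using c[of x] that closure_subset[of \<Omega>] by auto
  qed
qed

section \<open>Uniqueness and linearity of weak derivatives\<close>

text \<open>Lebesgue measure is complete, so a representative picked by the choice operator inherits
measurability from any function that it equals almost everywhere.\<close>

lemma borel_measurable_lebesgue_on_cong_AE:
  fixes f g :: "'a::euclidean_space \<Rightarrow> 'b::euclidean_space"
  assumes f: "f \<in> borel_measurable (lebesgue_on S)" and S: "S \<in> sets lebesgue"
    and ae: "AE x in lebesgue_on S. g x = f x"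
  shows "g \<in> borel_measurable (lebesgue_on S)"
proof -
  have "(\<lambda>x. if x \<in> S then g x else 0) \<in> borel_measurable lebesgue"
  proof (rule borel_measurable_AE)
    show "(\<lambda>x. if x \<in> S then f x else 0) \<in> borel_measurable lebesgue"
      using f S borel_measurable_if by blast
    have "AE x in lebesgue. x \<in> S \<longrightarrow> g x = f x"
      using ae S by (simp add: AE_restrict_space_iff)
    then show "AE x in lebesgue. (if x \<in> S then f x else 0) = (if x \<in> S then g x else 0)"
      by eventually_elim simp
  qed
  then show ?thesis
    using S borel_measurable_if by blast
qed

lemma locally_integrable_on_diff:
  "f locally_integrable_on \<Omega> \<Longrightarrow> g locally_integrable_on \<Omega> \<Longrightarrow>
    (\<lambda>x. f x - g x) locally_integrable_on \<Omega>"
  unfolding locally_integrable_on_def by (auto intro: set_integral_diff(1))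

lemma locally_integrable_on_scaleR:
  "f locally_integrable_on \<Omega> \<Longrightarrow> (\<lambda>x. c *\<^sub>R f x) locally_integrable_on \<Omega>"
  unfolding locally_integrable_on_def using absolutely_integrable_scaleR_left by blast

lemma locally_integrable_on_component:
  fixes f :: "'a::euclidean_space \<Rightarrow> real^'n"
  shows "f locally_integrable_on \<Omega> \<Longrightarrow> (\<lambda>x. f x $ i) locally_integrable_on \<Omega>"
  unfolding locally_integrable_on_def
  using absolutely_integrable_component[where f=f and b="axis i 1"] by (simp add: inner_axis)

lemma locally_integrable_on_vecI:
  fixes f :: "'a::euclidean_space \<Rightarrow> real^'n"
  assumes "\<And>i. (\<lambda>x. f x $ i) locally_integrable_on \<Omega>"
  shows "f locally_integrable_on \<Omega>"
  unfolding locally_integrable_on_def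
proof (intro allI impI, rule absolutely_integrable_componentwise)
  fix C and b :: "real^'n"
  assume C: "compact C \<and> C \<subseteq> \<Omega>"
  assume "b \<in> Basis"
  then obtain i where "b = axis i 1"
    by (auto simp: Basis_vec_def)
  then show "(\<lambda>x. f x \<bullet> b) absolutely_integrable_on C"
    using assms[of i] C by (simp add: locally_integrable_on_def inner_axis)
qed

lemma locally_integrable_on_sum:
  assumes "\<And>i. i \<in> I \<Longrightarrow> f i locally_integrable_on \<Omega>" "finite I"
  shows "(\<lambda>x. \<Sum>i\<in>I. f i x) locally_integrable_on \<Omega>"
  unfolding locally_integrable_on_def
proof (intro allI impI absolutely_integrable_sum)
  show "f i absolutely_integrable_on C" if "compact C \<and> C \<subseteq> \<Omega>" "i \<in> I" for C i
    using assms(1)[OF that(2)] that(1) by (simp add: locally_integrable_on_def)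
qed (use assms(2) in auto)

lemma test_function_continuous:
  assumes "\<phi> \<in> test_functions \<Omega>"
  shows "continuous_on UNIV \<phi>" "continuous_on UNIV (\<lambda>x. grad \<phi> x $ j)"
proof -
  have *: "Ck_on k \<phi> UNIV" for k
    using assms by (simp add: test_functions_def smooth_on_def)
  show "continuous_on UNIV \<phi>"
    using *[of 0] by simp
  show "continuous_on UNIV (\<lambda>x. grad \<phi> x $ j)"
    using *[of "Suc 0"] by (simp add: grad_def)
qed

lemma test_function_support:
  fixes \<phi> :: "real^'n \<Rightarrow> real"
  assumes "\<phi> \<in> test_functions \<Omega>"
  obtains C where "compact C" "C \<subseteq> \<Omega>" "\<And>x. x \<notin> C \<Longrightarrow> \<phi> x = 0" "\<And>x. x \<notin> C \<Longrightarrow> grad \<phi> x = 0"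
proof
  let ?C = "closure {x. \<phi> x \<noteq> 0}"
  show "compact ?C" "?C \<subseteq> \<Omega>"
    using assms by (auto simp: test_functions_def)
  show zero: "\<phi> x = 0" if "x \<notin> ?C" for x
    using that closure_subset[of "{x. \<phi> x \<noteq> 0}"] by blast
  show "grad \<phi> x = 0" if "x \<notin> ?C" for x
  proof -
    have "(\<phi> has_derivative (\<lambda>_. 0)) (at x)"
    proof (rule has_derivative_transform_within_open)
      show "((\<lambda>_. 0) has_derivative (\<lambda>_. 0)) (at x)"
        by (rule has_derivative_const)
      show "open (- ?C)" "x \<in> - ?C"
        using that by auto
      show "0 = \<phi> y" if "y \<in> - ?C" for y
        using zero[of y, symmetric] that by blast
    qed
    from frechet_derivative_at[OF this, symmetric] show ?thesis
      by (simp add: grad_def vec_eq_iff)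
  qed
qed

lemma integrable_locally_times_compact_support:
  fixes f \<psi> :: "real^'n \<Rightarrow> real"
  assumes f: "f locally_integrable_on \<Omega>" and \<psi>: "continuous_on UNIV \<psi>" and \<Omega>: "open \<Omega>"
    and C: "compact C" "C \<subseteq> \<Omega>" "\<And>x. x \<notin> C \<Longrightarrow> \<psi> x = 0"
  shows "integrable (lebesgue_on \<Omega>) (\<lambda>x. f x * \<psi> x)"
proof -
  have "C \<in> sets lebesgue"
    using C(1) by (simp add: compact_imp_closed borel_closed)
  then have "(\<lambda>x. \<psi> x * f x) absolutely_integrable_on C"
  proof (intro absolutely_integrable_bounded_measurable_product[OF bilinear_times])
    show "\<psi> \<in> borel_measurable (lebesgue_on C)"
      using \<psi> \<open>C \<in> sets lebesgue\<close> continuous_on_subset[of UNIV \<psi> C]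
      by (intro continuous_imp_measurable_on_sets_lebesgue) auto
    show "bounded (\<psi> ` C)"
      using \<psi> C(1) continuous_on_subset[of UNIV \<psi> C]
      by (intro compact_imp_bounded compact_continuous_image) auto
    show "f absolutely_integrable_on C"
      using f C by (simp add: locally_integrable_on_def)
  qed
  then have "integrable lebesgue (\<lambda>x. indicator C x *\<^sub>R (\<psi> x * f x))"
    by (simp add: set_integrable_def)
  also have "(\<lambda>x. indicator C x *\<^sub>R (\<psi> x * f x)) = (\<lambda>x. indicator \<Omega> x *\<^sub>R (f x * \<psi> x))"
    using C by (fastforce simp: indicator_def)
  finally show ?thesis
    using \<Omega> by (subst integrable_restrict_space) auto
qed

lemma integrable_times_test_function:
  fixes f :: "real^'n \<Rightarrow> real"
  assumes f: "f locally_integrable_on \<Omega>" and \<phi>: "\<phi> \<in> test_functions \<Omega>" and \<Omega>: "open \<Omega>"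
  shows "integrable (lebesgue_on \<Omega>) (\<lambda>x. f x * \<phi> x)"
    "integrable (lebesgue_on \<Omega>) (\<lambda>x. f x * grad \<phi> x $ j)"
proof -
  obtain C where C: "compact C" "C \<subseteq> \<Omega>" "\<And>x. x \<notin> C \<Longrightarrow> \<phi> x = 0" "\<And>x. x \<notin> C \<Longrightarrow> grad \<phi> x = 0"
    using test_function_support[OF \<phi>] by blast
  show "integrable (lebesgue_on \<Omega>) (\<lambda>x. f x * \<phi> x)"
    using C by (intro integrable_locally_times_compact_support[OF f test_function_continuous(1)[OF \<phi>] \<Omega>]) auto
  show "integrable (lebesgue_on \<Omega>) (\<lambda>x. f x * grad \<phi> x $ j)"
    using C by (intro integrable_locally_times_compact_support[OF f test_function_continuous(2)[OF \<phi>] \<Omega>]) auto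
qed

lemma integrable_inner_grad_test_function:
  fixes q :: "real^'n \<Rightarrow> real^'n"
  assumes q: "q locally_integrable_on \<Omega>" and \<phi>: "\<phi> \<in> test_functions \<Omega>" and \<Omega>: "open \<Omega>"
  shows "integrable (lebesgue_on \<Omega>) (\<lambda>x. q x \<bullet> grad \<phi> x)"
  unfolding inner_vec_def inner_real_def
  by (intro Bochner_Integration.integrable_sum
      integrable_times_test_function(2)[OF locally_integrable_on_component[OF q] \<phi> \<Omega>])

lemma is_weak_div_diff:
  assumes "is_weak_div \<Omega> q d" "is_weak_div \<Omega> q' d'" and \<Omega>: "open \<Omega>"
  shows "is_weak_div \<Omega> (\<lambda>x. q x - q' x) (\<lambda>x. d x - d' x)"
proof -
  have q: "q locally_integrable_on \<Omega>" "q' locally_integrable_on \<Omega>"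
    and d: "d locally_integrable_on \<Omega>" "d' locally_integrable_on \<Omega>"
    using assms by (simp_all add: is_weak_div_def)
  have "(LINT x|lebesgue_on \<Omega>. (q x - q' x) \<bullet> grad \<phi> x) = - (LINT x|lebesgue_on \<Omega>. (d x - d' x) * \<phi> x)"
    if \<phi>: "\<phi> \<in> test_functions \<Omega>" for \<phi>
  proof -
    have "(LINT x|lebesgue_on \<Omega>. (q x - q' x) \<bullet> grad \<phi> x)
        = (LINT x|lebesgue_on \<Omega>. q x \<bullet> grad \<phi> x) - (LINT x|lebesgue_on \<Omega>. q' x \<bullet> grad \<phi> x)"
      unfolding inner_diff_left
      by (intro Bochner_Integration.integral_diff integrable_inner_grad_test_function q \<phi> \<Omega>)
    also have "\<dots> = - ((LINT x|lebesgue_on \<Omega>. d x * \<phi> x) - (LINT x|lebesgue_on \<Omega>. d' x * \<phi> x))"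
      using assms \<phi> by (simp add: is_weak_div_def)
    also have "(LINT x|lebesgue_on \<Omega>. d x * \<phi> x) - (LINT x|lebesgue_on \<Omega>. d' x * \<phi> x)
        = (LINT x|lebesgue_on \<Omega>. (d x - d' x) * \<phi> x)"
      unfolding left_diff_distrib
      by (intro Bochner_Integration.integral_diff[symmetric] integrable_times_test_function(1)[OF _ \<phi> \<Omega>] d)
    finally show ?thesis .
  qed
  then show ?thesis
    using q d by (simp add: is_weak_div_def locally_integrable_on_diff)
qed

lemma is_weak_div_scaleR:
  assumes "is_weak_div \<Omega> q d"
  shows "is_weak_div \<Omega> (\<lambda>x. c *\<^sub>R q x) (\<lambda>x. c * d x)"
proof -
  have "q locally_integrable_on \<Omega>" "d locally_integrable_on \<Omega>"
    using assms by (simp_all add: is_weak_div_def)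
  then have "(\<lambda>x. c *\<^sub>R q x) locally_integrable_on \<Omega>" "(\<lambda>x. c * d x) locally_integrable_on \<Omega>"
    using locally_integrable_on_scaleR[of q \<Omega> c] locally_integrable_on_scaleR[of d \<Omega> c] by simp_all
  then show ?thesis
    using assms by (simp add: is_weak_div_def mult.assoc)
qed

text \<open>Uniqueness is what makes the representatives \<open>weak_div\<close> and \<open>weak_grad\<close>, which are picked by choice,
linear up to null sets.\<close>

lemma is_weak_div_unique:
  assumes "is_weak_div \<Omega> q d" "is_weak_div \<Omega> q d'" and \<Omega>: "open \<Omega>"
  shows "AE x in lebesgue_on \<Omega>. d x = d' x"
proof -
  have "is_weak_div \<Omega> (\<lambda>x. q x - q x) (\<lambda>x. d x - d' x)"
    using assms by (rule is_weak_div_diff)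
  then have "AE x in lebesgue_on \<Omega>. d x - d' x = 0"
    by (intro du_bois_reymond \<Omega>) (auto simp: is_weak_div_def)
  then show ?thesis
    by simp
qed

lemma weak_div_AE_eq:
  assumes "is_weak_div \<Omega> q d" "open \<Omega>"
  shows "AE x in lebesgue_on \<Omega>. weak_div \<Omega> q x = d x"
  using is_weak_div_unique[OF someI[of "is_weak_div \<Omega> q", OF assms(1)] assms]
  by (simp add: weak_div_def)

lemma weak_div_square_integrable:
  assumes "is_weak_div \<Omega> q d" "square_integrable (lebesgue_on \<Omega>) d" and \<Omega>: "open \<Omega>"
  shows "square_integrable (lebesgue_on \<Omega>) (weak_div \<Omega> q)"
proof -
  have ae: "AE x in lebesgue_on \<Omega>. weak_div \<Omega> q x = d x"
    using assms(1) \<Omega> by (rule weak_div_AE_eq)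
  have "weak_div \<Omega> q \<in> borel_measurable (lebesgue_on \<Omega>)"
    using assms(2) \<Omega> by (intro borel_measurable_lebesgue_on_cong_AE[OF _ _ ae]) (auto simp: square_integrable_def)
  then show ?thesis
    by (rule square_integrable_cong_AE[OF assms(2) _ ae])
qed

lemma is_weak_div_weak_div: "is_weak_div \<Omega> q d \<Longrightarrow> is_weak_div \<Omega> q (weak_div \<Omega> q)"
  unfolding weak_div_def by (rule someI[of "is_weak_div \<Omega> q" d])

lemma is_weak_grad_diff:
  assumes "is_weak_grad \<Omega> f F" "is_weak_grad \<Omega> g G" and \<Omega>: "open \<Omega>"
  shows "is_weak_grad \<Omega> (\<lambda>x. f x - g x) (\<lambda>x. F x - G x)"
proof -
  have f: "f locally_integrable_on \<Omega>" "g locally_integrable_on \<Omega>"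
    and F: "F locally_integrable_on \<Omega>" "G locally_integrable_on \<Omega>"
    using assms unfolding is_weak_grad_def by blast+
  have "(LINT x|lebesgue_on \<Omega>. (f x - g x) * grad \<phi> x $ j) = - (LINT x|lebesgue_on \<Omega>. (F x - G x) $ j * \<phi> x)"
    if \<phi>: "\<phi> \<in> test_functions \<Omega>" for \<phi> j
  proof -
    have "(LINT x|lebesgue_on \<Omega>. (f x - g x) * grad \<phi> x $ j)
        = (LINT x|lebesgue_on \<Omega>. f x * grad \<phi> x $ j) - (LINT x|lebesgue_on \<Omega>. g x * grad \<phi> x $ j)"
      unfolding left_diff_distrib
      by (intro Bochner_Integration.integral_diff integrable_times_test_function(2)[OF _ \<phi> \<Omega>] f)
    also have "\<dots> = - ((LINT x|lebesgue_on \<Omega>. F x $ j * \<phi> x) - (LINT x|lebesgue_on \<Omega>. G x $ j * \<phi> x))"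
      using assms \<phi> by (simp add: is_weak_grad_def)
    also have "(LINT x|lebesgue_on \<Omega>. F x $ j * \<phi> x) - (LINT x|lebesgue_on \<Omega>. G x $ j * \<phi> x)
        = (LINT x|lebesgue_on \<Omega>. (F x - G x) $ j * \<phi> x)"
      unfolding vector_minus_component left_diff_distrib
      by (intro Bochner_Integration.integral_diff[symmetric]
          integrable_times_test_function(1)[OF locally_integrable_on_component \<phi> \<Omega>] F)
    finally show ?thesis .
  qed
  then show ?thesis
    using f F by (simp add: is_weak_grad_def locally_integrable_on_diff)
qed

lemma is_weak_grad_unique:
  fixes \<Omega> :: "(real^'n) set"
  assumes "is_weak_grad \<Omega> f F" "is_weak_grad \<Omega> f G" and \<Omega>: "open \<Omega>"
  shows "AE x in lebesgue_on \<Omega>. F x = G x"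
proof -
  have D: "is_weak_grad \<Omega> (\<lambda>x. f x - f x) (\<lambda>x. F x - G x)"
    using assms by (rule is_weak_grad_diff)
  have "AE x in lebesgue_on \<Omega>. F x $ j - G x $ j = 0" for j
    using D locally_integrable_on_component[of "\<lambda>x. F x - G x" \<Omega> j]
    by (intro du_bois_reymond \<Omega>) (auto simp: is_weak_grad_def)
  then have "AE x in lebesgue_on \<Omega>. \<forall>j\<in>UNIV. F x $ j - G x $ j = 0"
    by (intro AE_finite_allI) auto
  then show ?thesis
    by eventually_elim (simp add: vec_eq_iff)
qed

lemma is_weak_grad_weak_grad: "is_weak_grad \<Omega> f G \<Longrightarrow> is_weak_grad \<Omega> f (weak_grad \<Omega> f)"
  unfolding weak_grad_def by (rule someI[of "is_weak_grad \<Omega> f" G])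

lemma H1_weak_grad:
  fixes \<Omega> :: "(real^'n) set"
  assumes "f \<in> H1 \<Omega>" "open \<Omega>"
  shows "is_weak_grad \<Omega> f (weak_grad \<Omega> f)" "square_integrable (lebesgue_on \<Omega>) (weak_grad \<Omega> f)"
proof -
  obtain G where G: "is_weak_grad \<Omega> f G" "square_integrable (lebesgue_on \<Omega>) G"
    using assms by (auto simp: H1_def)
  show f: "is_weak_grad \<Omega> f (weak_grad \<Omega> f)"
    using G(1) by (rule is_weak_grad_weak_grad)
  have ae: "AE x in lebesgue_on \<Omega>. weak_grad \<Omega> f x = G x"
    using is_weak_grad_unique[OF f G(1) assms(2)] .
  have "weak_grad \<Omega> f \<in> borel_measurable (lebesgue_on \<Omega>)"
    using G assms by (intro borel_measurable_lebesgue_on_cong_AE[OF _ _ ae]) (auto simp: square_integrable_def)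
  then show "square_integrable (lebesgue_on \<Omega>) (weak_grad \<Omega> f)"
    by (rule square_integrable_cong_AE[OF G(2) _ ae])
qed

lemma weak_grad_diff_AE:
  assumes "f \<in> H1 \<Omega>" "g \<in> H1 \<Omega>" and \<Omega>: "open \<Omega>"
  shows "AE x in lebesgue_on \<Omega>. weak_grad \<Omega> (\<lambda>y. f y - g y) x = weak_grad \<Omega> f x - weak_grad \<Omega> g x"
proof -
  have "is_weak_grad \<Omega> (\<lambda>y. f y - g y) (\<lambda>x. weak_grad \<Omega> f x - weak_grad \<Omega> g x)"
    using assms by (intro is_weak_grad_diff H1_weak_grad)
  from is_weak_grad_unique[OF is_weak_grad_weak_grad[OF this] this \<Omega>] show ?thesis .
qed

lemma is_weak_div_sum_weak_grad:
  fixes v :: "real^'n \<Rightarrow> real^'n"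
  assumes G: "\<And>i. is_weak_grad \<Omega> (\<lambda>x. v x $ i) (G i)" and \<Omega>: "open \<Omega>"
  shows "is_weak_div \<Omega> v (\<lambda>x. \<Sum>i\<in>UNIV. G i x $ i)"
proof -
  have v: "(\<lambda>x. v x $ i) locally_integrable_on \<Omega>" and Gi: "(\<lambda>x. G i x $ j) locally_integrable_on \<Omega>" for i j
    using G unfolding is_weak_grad_def by (blast intro: locally_integrable_on_component)+
  have "(LINT x|lebesgue_on \<Omega>. v x \<bullet> grad \<phi> x) = - (LINT x|lebesgue_on \<Omega>. (\<Sum>i\<in>UNIV. G i x $ i) * \<phi> x)"
    if \<phi>: "\<phi> \<in> test_functions \<Omega>" for \<phi>
  proof -
    have "(LINT x|lebesgue_on \<Omega>. v x \<bullet> grad \<phi> x)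
        = (LINT x|lebesgue_on \<Omega>. (\<Sum>i\<in>UNIV. v x $ i * grad \<phi> x $ i))"
      by (simp add: inner_vec_def)
    also have "\<dots> = (\<Sum>i\<in>UNIV. LINT x|lebesgue_on \<Omega>. v x $ i * grad \<phi> x $ i)"
      by (rule Bochner_Integration.integral_sum) (rule integrable_times_test_function(2)[OF v \<phi> \<Omega>])
    also have "\<dots> = (\<Sum>i\<in>UNIV. - (LINT x|lebesgue_on \<Omega>. G i x $ i * \<phi> x))"
      using G \<phi> by (intro sum.cong refl) (auto simp: is_weak_grad_def)
    also have "\<dots> = - (\<Sum>i\<in>UNIV. LINT x|lebesgue_on \<Omega>. G i x $ i * \<phi> x)"
      by (rule sum_negf)
    also have "(\<Sum>i\<in>UNIV. LINT x|lebesgue_on \<Omega>. G i x $ i * \<phi> x)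
        = (LINT x|lebesgue_on \<Omega>. (\<Sum>i\<in>UNIV. G i x $ i * \<phi> x))"
      by (rule Bochner_Integration.integral_sum[symmetric]) (rule integrable_times_test_function(1)[OF Gi \<phi> \<Omega>])
    also have "\<dots> = (LINT x|lebesgue_on \<Omega>. (\<Sum>i\<in>UNIV. G i x $ i) * \<phi> x)"
      by (simp add: sum_distrib_right)
    finally show ?thesis .
  qed
  then show ?thesis
    unfolding is_weak_div_def using v Gi
    by (intro conjI ballI locally_integrable_on_vecI locally_integrable_on_sum) auto
qed

section \<open>Square roots and inverses of coercive matrices\<close>

lemma symmetric_matrix_inner_swap:
  fixes A :: "real^'n^'n"
  assumes "transpose A = A"
  shows "(A *v v) \<bullet> w = v \<bullet> (A *v w)"
  using assms by (metis dot_lmul_matrix transpose_matrix_vector)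

text \<open>The hypothesis \<open>bound\<close> makes \<open>1 - A / c\<close> an operator of norm at most \<open>1\<close>.  It holds for every positive
semidefinite \<open>A\<close> as soon as \<open>c\<close> is at least the largest eigenvalue, and it is immediate for the inverse
of a coercive matrix.  With \<open>B = 1 - A / c\<close> the equation \<open>(1 - X)\<^sup>2 = A / c\<close> reads \<open>X = (B + X\<^sup>2) / 2\<close>.
The right-hand side maps the compact convex set of symmetric matrices of operator norm at most \<open>1\<close>
into itself, so Brouwer's theorem gives a solution, and \<open>1 - X\<close> is positive semidefinite.\<close>

lemma symmetric_matrix_sqrt_exists:
  fixes A :: "real^'n^'n"
  assumes sym: "transpose A = A"
    and c: "c > 0" and bound: "\<And>v. (norm (A *v v))\<^sup>2 \<le> c * (v \<bullet> (A *v v))"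
  shows "\<exists>S. transpose S = S \<and> (\<forall>v. 0 \<le> v \<bullet> (S *v v)) \<and> S ** S = A"
proof -
  define B where "B = mat 1 - (1 / c) *\<^sub>R A"
  define \<X> :: "(real^'n^'n) set"
    where "\<X> = {X. transpose X = X} \<inter> {X. \<forall>v. norm (X *v v) \<le> norm v}"
  have Bv: "B *v v = v - (1 / c) *\<^sub>R (A *v v)" for v
    by (simp add: B_def matrix_vector_mult_diff_rdistrib scaleR_matrix_vector_assoc)
  have "norm (B *v v) \<le> norm v" for v
  proof -
    have "(norm (B *v v))\<^sup>2 = (norm v)\<^sup>2 - 2 / c * (v \<bullet> (A *v v)) + (1 / c)\<^sup>2 * (norm (A *v v))\<^sup>2"
      unfolding Bv power2_norm_eq_inner
      by (simp add: inner_diff_left inner_diff_right inner_commute power2_eq_square)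
    also have "\<dots> \<le> (norm v)\<^sup>2 - 2 / c * (v \<bullet> (A *v v)) + (1 / c)\<^sup>2 * (c * (v \<bullet> (A *v v)))"
      by (intro add_left_mono mult_left_mono bound) auto
    also have "\<dots> = (norm v)\<^sup>2 - 1 / c * (v \<bullet> (A *v v))"
      using c by (simp add: power2_eq_square field_simps)
    also have "\<dots> \<le> (norm v)\<^sup>2"
      using bound[of v] c order_trans[OF zero_le_power2 bound[of v]] by (simp add: zero_le_mult_iff)
    finally show ?thesis
      by (simp add: power2_le_iff_abs_le)
  qed
  moreover have "transpose B = B"
    using sym by (simp add: B_def transpose_def vec_eq_iff mat_def)
  ultimately have B: "B \<in> \<X>"
    by (simp add: \<X>_def)
  have "bounded \<X>"
  proof -
    have "norm X \<le> real CARD('n)" if "X \<in> \<X>" for X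
    proof -
      have "norm (X $ i) \<le> 1" for i
      proof -
        \<comment> \<open>By symmetry the rows are the images of the unit vectors.\<close>
        have "X $ i = row i (transpose X)"
          using that by (simp add: \<X>_def row_def vec_eq_iff)
        also have "\<dots> = X *v axis i 1"
          by (simp add: row_transpose matrix_vector_mult_basis)
        finally show ?thesis
          using that by (simp add: \<X>_def) (metis norm_axis_1)
      qed
      then have "norm X \<le> (\<Sum>i\<in>(UNIV::'n set). 1)"
        unfolding norm_vec_def[of X] by (intro order_trans[OF L2_set_le_sum] sum_mono) auto
      then show ?thesis
        by simp
    qed
    then show ?thesis
      by (auto simp: bounded_iff)
  qed
  moreover have "closed \<X>"
  proof -
    have "continuous_on UNIV (\<lambda>X::real^'n^'n. transpose X)"
      unfolding transpose_def by (intro continuous_intros)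
    moreover have "continuous_on UNIV (\<lambda>X::real^'n^'n. X *v v)" for v
      unfolding matrix_vector_mult_def by (intro continuous_intros)
    ultimately show ?thesis
      unfolding \<X>_def
      by (intro closed_Int closed_Collect_eq closed_Collect_all closed_Collect_le continuous_intros)
  qed
  ultimately have compact: "compact \<X>"
    by (simp add: compact_eq_bounded_closed)
  have convex: "convex \<X>"
  proof (rule convexI)
    fix X Y :: "real^'n^'n" and s t :: real
    assume XY: "X \<in> \<X>" "Y \<in> \<X>" and st: "0 \<le> s" "0 \<le> t" "s + t = 1"
    have "norm ((s *\<^sub>R X + t *\<^sub>R Y) *v v) \<le> norm v" for v
    proof -
      have "norm ((s *\<^sub>R X + t *\<^sub>R Y) *v v) \<le> s * norm (X *v v) + t * norm (Y *v v)"
        using st norm_triangle_ineq[of "s *\<^sub>R (X *v v)" "t *\<^sub>R (Y *v v)"]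
        by (simp add: matrix_vector_mult_add_rdistrib scaleR_matrix_vector_assoc[symmetric])
      also have "\<dots> \<le> s * norm v + t * norm v"
        using XY st by (intro add_mono mult_left_mono) (auto simp: \<X>_def)
      also have "\<dots> = norm v"
        using st by (metis distrib_right mult_1)
      finally show ?thesis .
    qed
    moreover have "transpose (s *\<^sub>R X + t *\<^sub>R Y) = s *\<^sub>R transpose X + t *\<^sub>R transpose Y"
      by (simp add: transpose_def vec_eq_iff)
    ultimately show "s *\<^sub>R X + t *\<^sub>R Y \<in> \<X>"
      using XY by (simp add: \<X>_def)
  qed
  have cont: "continuous_on \<X> (\<lambda>X. (1 / 2) *\<^sub>R (B + X ** X))"
    unfolding matrix_matrix_mult_def by (intro continuous_intros)
  have maps: "(\<lambda>X. (1 / 2) *\<^sub>R (B + X ** X)) \<in> \<X> \<rightarrow> \<X>"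
  proof
    fix X assume X: "X \<in> \<X>"
    have "transpose ((1 / 2) *\<^sub>R (B + X ** X)) = (1 / 2) *\<^sub>R (transpose B + transpose (X ** X))"
      by (simp add: transpose_def vec_eq_iff)
    also have "\<dots> = (1 / 2) *\<^sub>R (B + X ** X)"
      using X B by (simp add: \<X>_def matrix_transpose_mul)
    finally have "transpose ((1 / 2) *\<^sub>R (B + X ** X)) = (1 / 2) *\<^sub>R (B + X ** X)" .
    moreover have "norm (((1 / 2) *\<^sub>R (B + X ** X)) *v v) \<le> norm v" for v
    proof -
      have "norm (X *v (X *v v)) \<le> norm v"
        using X order_trans[of "norm (X *v (X *v v))" "norm (X *v v)" "norm v"] by (auto simp: \<X>_def)
      moreover have "norm (B *v v) \<le> norm v"
        using B by (simp add: \<X>_def)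
      moreover have "((1 / 2) *\<^sub>R (B + X ** X)) *v v = (1 / 2) *\<^sub>R (B *v v + X *v (X *v v))"
        by (simp add: matrix_vector_mult_add_rdistrib scaleR_matrix_vector_assoc[symmetric]
            matrix_vector_mul_assoc)
      ultimately show ?thesis
        using norm_triangle_ineq[of "B *v v" "X *v (X *v v)"] by simp
    qed
    ultimately show "(1 / 2) *\<^sub>R (B + X ** X) \<in> \<X>"
      by (simp add: \<X>_def)
  qed
  have "\<X> \<noteq> {}"
    using B by blast
  from brouwer[OF compact convex this cont maps]
  obtain X where X: "X \<in> \<X>" and fix_pt: "(1 / 2) *\<^sub>R (B + X ** X) = X"
    by blast
  define S where "S = sqrt c *\<^sub>R (mat 1 - X)"
  have Sv: "S *v v = sqrt c *\<^sub>R (v - X *v v)" for v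
    by (simp add: S_def matrix_vector_mult_diff_rdistrib scaleR_matrix_vector_assoc[symmetric])
  have "transpose S = S"
    using X by (simp add: S_def \<X>_def transpose_def vec_eq_iff mat_def)
  moreover have "0 \<le> v \<bullet> (S *v v)" for v
  proof -
    have "v \<bullet> (X *v v) \<le> norm v * norm (X *v v)"
      by (rule norm_cauchy_schwarz)
    also have "\<dots> \<le> norm v * norm v"
      using X by (intro mult_left_mono) (auto simp: \<X>_def)
    finally show ?thesis
      using c by (simp add: Sv inner_diff_right dot_square_norm power2_eq_square)
  qed
  moreover have "S ** S = A"
  proof -
    have "(S ** S) *v v = A *v v" for v
    proof -
      have "X *v v = (1 / 2) *\<^sub>R (B *v v + X *v (X *v v))"
        by (subst fix_pt[symmetric]) (simp add: matrix_vector_mult_add_rdistrib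
            scaleR_matrix_vector_assoc[symmetric] matrix_vector_mul_assoc)
      then have "2 *\<^sub>R (X *v v) = 2 *\<^sub>R ((1 / 2) *\<^sub>R (B *v v + X *v (X *v v)))"
        by (rule arg_cong)
      also have "\<dots> = B *v v + X *v (X *v v)"
        by simp
      finally have "2 *\<^sub>R (X *v v) = B *v v + X *v (X *v v)" .
      then have "X *v (X *v v) = 2 *\<^sub>R (X *v v) - v + (1 / c) *\<^sub>R (A *v v)"
        by (simp add: Bv)
      moreover have "(S ** S) *v v
          = sqrt c *\<^sub>R sqrt c *\<^sub>R (v - 2 *\<^sub>R (X *v v) + X *v (X *v v))"
        by (simp add: matrix_vector_mul_assoc[symmetric] Sv matrix_vector_mult_diff_distrib
            matrix_vector_mult_scaleR scaleR_2 scaleR_diff_right scaleR_add_right)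
      ultimately show ?thesis
        using c by simp
    qed
    then show ?thesis
      by (simp add: matrix_eq)
  qed
  ultimately show ?thesis
    by blast
qed

lemma matrix_sqrt_inner_self:
  fixes A :: "real^'n^'n"
  assumes "transpose A = A" "c > 0" "\<And>v. (norm (A *v v))\<^sup>2 \<le> c * (v \<bullet> (A *v v))"
  shows "(matrix_sqrt A *v v) \<bullet> (matrix_sqrt A *v v) = (A *v v) \<bullet> v"
proof -
  have "transpose (matrix_sqrt A) = matrix_sqrt A" "matrix_sqrt A ** matrix_sqrt A = A"
    using someI_ex[OF symmetric_matrix_sqrt_exists[OF assms]] unfolding matrix_sqrt_def by auto
  then show ?thesis
    by (metis matrix_vector_mul_assoc symmetric_matrix_inner_swap inner_commute)
qed

lemma matrix_inv_inverse:
  fixes A :: "real^'n^'n"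
  assumes "invertible A"
  shows "A ** matrix_inv A = mat 1" "matrix_inv A ** A = mat 1"
  using someI_ex[OF assms[unfolded invertible_def]] unfolding matrix_inv_def by auto

lemma coercive_matrix_inv:
  fixes A :: "real^'n^'n"
  assumes sym: "transpose A = A" and c: "c > 0" and coer: "\<And>\<xi>. c * (\<xi> \<bullet> \<xi>) \<le> \<xi> \<bullet> (A *v \<xi>)"
  shows "invertible A" "transpose (matrix_inv A) = matrix_inv A"
    "(norm (matrix_inv A *v v))\<^sup>2 \<le> 1 / c * (v \<bullet> (matrix_inv A *v v))"
    "norm (matrix_inv A *v v) \<le> 1 / c * norm v"
proof -
  have "\<xi> = 0" if "A *v \<xi> = 0" for \<xi>
    using coer[of \<xi>] c that by (metis inner_gt_zero_iff inner_zero_right mult_pos_pos not_le)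
  then show inv: "invertible A"
    using invertible_left_inverse matrix_left_invertible_ker by blast
  then have AI: "A ** matrix_inv A = mat 1" "matrix_inv A ** A = mat 1"
    by (auto simp: matrix_inv_inverse)
  have "A ** transpose (matrix_inv A) = mat 1"
    using AI sym by (metis matrix_transpose_mul transpose_mat)
  then show "transpose (matrix_inv A) = matrix_inv A"
    using AI by (metis matrix_mul_assoc matrix_mul_lid matrix_mul_rid)
  define w where "w = matrix_inv A *v v"
  have "v = A *v w"
    using AI by (simp add: w_def matrix_vector_mul_assoc)
  then have *: "c * (w \<bullet> w) \<le> v \<bullet> w"
    using coer[of w] by (simp add: inner_commute)
  then show "(norm (matrix_inv A *v v))\<^sup>2 \<le> 1 / c * (v \<bullet> (matrix_inv A *v v))"
    using c by (simp add: w_def[symmetric] power2_norm_eq_inner field_simps)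
  have "c * norm w * norm w \<le> norm v * norm w"
    using * norm_cauchy_schwarz[of v w] by (simp add: dot_square_norm power2_eq_square mult.assoc)
  then have "c * norm w \<le> norm v"
    by (cases "w = 0") auto
  then show "norm (matrix_inv A *v v) \<le> 1 / c * norm v"
    using c by (simp add: w_def[symmetric] field_simps)
qed

lemma borel_measurable_det:
  fixes A :: "'a \<Rightarrow> real^'n^'n"
  assumes "\<And>i j. (\<lambda>x. A x $ i $ j) \<in> borel_measurable M"
  shows "(\<lambda>x. det (A x)) \<in> borel_measurable M"
  unfolding det_def
  by (intro borel_measurable_sum borel_measurable_times borel_measurable_const borel_measurable_prod assms)

text \<open>By Cramer's rule the components are quotients of determinants.\<close>

lemma borel_measurable_matrix_inv_mult:
  fixes A :: "'a \<Rightarrow> real^'n^'n"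
  assumes A: "A \<in> borel_measurable M" and f: "f \<in> borel_measurable M"
    and inv: "\<And>x. x \<in> space M \<Longrightarrow> invertible (A x)"
  shows "(\<lambda>x. matrix_inv (A x) *v f x) \<in> borel_measurable M"
proof (rule borel_measurable_vecI)
  fix k
  have Aij: "(\<lambda>x. A x $ i $ j) \<in> borel_measurable M" for i j
    by (intro borel_measurable_vec_nth A)
  have "(\<lambda>x. det (\<chi> i j. if j = k then f x $ i else A x $ i $ j) / det (A x)) \<in> borel_measurable M"
  proof (intro borel_measurable_divide borel_measurable_det Aij)
    show "(\<lambda>x. (\<chi> i j. if j = k then f x $ i else A x $ i $ j) $ i $ j) \<in> borel_measurable M" for i j
      using Aij f by (cases "j = k") (auto intro: borel_measurable_vec_nth)
  qed
  moreover have "(matrix_inv (A x) *v f x) $ k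
      = det (\<chi> i j. if j = k then f x $ i else A x $ i $ j) / det (A x)" if "x \<in> space M" for x
  proof -
    have "A x *v (matrix_inv (A x) *v f x) = f x"
      using inv[OF that] by (simp add: matrix_vector_mul_assoc matrix_inv_inverse)
    then show ?thesis
      using cramer[of "A x" "matrix_inv (A x) *v f x" "f x"] inv[OF that]
      by (simp add: invertible_det_nz)
  qed
  ultimately show "(\<lambda>x. (matrix_inv (A x) *v f x) $ k) \<in> borel_measurable M"
    by (simp cong: measurable_cong)
qed

section \<open>The discrete spaces and the strain\<close>

lemma Qh_diff:
  assumes p: "p \<in> Qh \<Omega> \<T>" and q: "q \<in> Qh \<Omega> \<T>"
  shows "(\<lambda>x. p x - q x) \<in> Qh \<Omega> \<T>"
proof -
  have "\<exists>c. (AE x in lebesgue_on T. p x - q x = c) \<and>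
      (emeasure surface_measure (frontier \<Omega> \<inter> T) > 0 \<longrightarrow> c = 0)" if T: "T \<in> \<T>" for T
  proof -
    obtain c where c: "AE x in lebesgue_on T. p x = c"
      "emeasure surface_measure (frontier \<Omega> \<inter> T) > 0 \<longrightarrow> c = 0"
      using p T unfolding Qh_def by blast
    obtain c' where c': "AE x in lebesgue_on T. q x = c'"
      "emeasure surface_measure (frontier \<Omega> \<inter> T) > 0 \<longrightarrow> c' = 0"
      using q T unfolding Qh_def by blast
    have "AE x in lebesgue_on T. p x - q x = c - c'"
      using c(1) c'(1) by eventually_elim simp
    then show ?thesis
      using c(2) c'(2) by (intro exI[of _ "c - c'"]) auto
  qed
  moreover have "square_integrable (lebesgue_on \<Omega>) (\<lambda>x. p x - q x)"
    using p q by (intro square_integrable_diff) (simp_all add: Qh_def)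
  ultimately show ?thesis
    by (simp add: Qh_def)
qed

lemma Hdiv_weak_div:
  assumes q: "q \<in> Hdiv \<Omega>" and \<Omega>: "open \<Omega>"
  shows "is_weak_div \<Omega> q (weak_div \<Omega> q)" "square_integrable (lebesgue_on \<Omega>) (weak_div \<Omega> q)"
proof -
  obtain d where d: "is_weak_div \<Omega> q d" "square_integrable (lebesgue_on \<Omega>) d"
    using q by (auto simp: Hdiv_def)
  show "is_weak_div \<Omega> q (weak_div \<Omega> q)"
    using d(1) by (rule is_weak_div_weak_div)
  show "square_integrable (lebesgue_on \<Omega>) (weak_div \<Omega> q)"
    using d \<Omega> by (rule weak_div_square_integrable)
qed

lemma weak_div_diff:
  assumes q: "is_weak_div \<Omega> q (weak_div \<Omega> q)" "square_integrable (lebesgue_on \<Omega>) (weak_div \<Omega> q)"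
    and r: "is_weak_div \<Omega> r (weak_div \<Omega> r)" "square_integrable (lebesgue_on \<Omega>) (weak_div \<Omega> r)"
    and \<Omega>: "open \<Omega>"
  shows "is_weak_div \<Omega> (\<lambda>x. q x - r x) (\<lambda>x. weak_div \<Omega> q x - weak_div \<Omega> r x)"
    "AE x in lebesgue_on \<Omega>. weak_div \<Omega> (\<lambda>x. q x - r x) x = weak_div \<Omega> q x - weak_div \<Omega> r x"
    "square_integrable (lebesgue_on \<Omega>) (weak_div \<Omega> (\<lambda>x. q x - r x))"
proof -
  show *: "is_weak_div \<Omega> (\<lambda>x. q x - r x) (\<lambda>x. weak_div \<Omega> q x - weak_div \<Omega> r x)"
    using q(1) r(1) \<Omega> by (rule is_weak_div_diff)
  show "AE x in lebesgue_on \<Omega>. weak_div \<Omega> (\<lambda>x. q x - r x) x = weak_div \<Omega> q x - weak_div \<Omega> r x"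
    using * \<Omega> by (rule weak_div_AE_eq)
  show "square_integrable (lebesgue_on \<Omega>) (weak_div \<Omega> (\<lambda>x. q x - r x))"
    using * square_integrable_diff[OF q(2) r(2)] \<Omega> by (rule weak_div_square_integrable)
qed

text \<open>The boundedness of \<open>\<Omega>\<close> makes every globally smooth \<open>\<phi>\<close>, together with its gradient, square-integrable
on \<open>\<Omega>\<close>.\<close>

lemma zero_normal_trace_diff:
  assumes q: "q \<in> Hdiv \<Omega>" "zero_normal_trace \<Omega> q" and r: "r \<in> Hdiv \<Omega>" "zero_normal_trace \<Omega> r"
    and \<Omega>: "open \<Omega>" "bounded \<Omega>"
  shows "zero_normal_trace \<Omega> (\<lambda>x. q x - r x)"
  unfolding zero_normal_trace_def
proof (intro allI impI)
  fix \<phi> :: "real^'a \<Rightarrow> real" assume \<phi>: "\<phi> smooth_on UNIV"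
  let ?L = "lebesgue_on \<Omega>"
  have Ck: "Ck_on k \<phi> UNIV" for k
    using \<phi> by (simp add: smooth_on_def)
  have sq_\<phi>: "square_integrable ?L \<phi>"
    using Ck[of 0] \<Omega> by (intro square_integrable_continuous) auto
  have "continuous_on UNIV (grad \<phi>)"
    unfolding grad_def using Ck[of "Suc 0"] by (intro continuous_on_vec_lambda) auto
  then have sq_grad: "square_integrable ?L (grad \<phi>)"
    using \<Omega> by (rule square_integrable_continuous)
  note dq = Hdiv_weak_div[OF q(1) \<Omega>(1)] and dr = Hdiv_weak_div[OF r(1) \<Omega>(1)]
  note diff = weak_div_diff[OF dq dr \<Omega>(1)]
  have sq: "square_integrable ?L q" "square_integrable ?L r"
    using q r by (simp_all add: Hdiv_def)
  have "L2_inner ?L (weak_div \<Omega> (\<lambda>x. q x - r x)) \<phi> = L2_inner ?L (\<lambda>x. weak_div \<Omega> q x - weak_div \<Omega> r x) \<phi>"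
    using diff(2,3) square_integrable_diff[OF dq(2) dr(2)] sq_\<phi>
    by (intro L2_inner_cong_AE) (auto simp: square_integrable_def)
  also have "\<dots> = L2_inner ?L (weak_div \<Omega> q) \<phi> - L2_inner ?L (weak_div \<Omega> r) \<phi>"
    by (intro L2_inner_diff_left dq dr sq_\<phi>)
  moreover have "L2_inner ?L (\<lambda>x. q x - r x) (grad \<phi>) = L2_inner ?L q (grad \<phi>) - L2_inner ?L r (grad \<phi>)"
    by (intro L2_inner_diff_left sq sq_grad)
  moreover have "L2_inner ?L q (grad \<phi>) + L2_inner ?L (weak_div \<Omega> q) \<phi> = 0"
    "L2_inner ?L r (grad \<phi>) + L2_inner ?L (weak_div \<Omega> r) \<phi> = 0"
    using q(2) r(2) \<phi> unfolding zero_normal_trace_def by blast+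
  ultimately show "L2_inner ?L (\<lambda>x. q x - r x) (grad \<phi>)
      + L2_inner ?L (weak_div \<Omega> (\<lambda>x. q x - r x)) \<phi> = 0"
    by linarith
qed

lemma piecewise_P1_diff:
  assumes v: "piecewise_P1 \<T> v" and w: "piecewise_P1 \<T> w"
  shows "piecewise_P1 \<T> (\<lambda>x. v x - w x)"
  unfolding piecewise_P1_def
proof
  fix T assume T: "T \<in> \<T>"
  obtain A b where A: "AE x in lebesgue_on T. v x = A *v x + b"
    using v T unfolding piecewise_P1_def by blast
  obtain B c where B: "AE x in lebesgue_on T. w x = B *v x + c"
    using w T unfolding piecewise_P1_def by blast
  have "AE x in lebesgue_on T. v x - w x = (A - B) *v x + (b - c)"
    using A B by eventually_elim (simp add: matrix_vector_mult_diff_rdistrib)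
  then show "\<exists>A b. AE x in lebesgue_on T. v x - w x = A *v x + b"
    by blast
qed

lemma Zh_diff:
  assumes q: "q \<in> Zh \<Omega> \<T>" and r: "r \<in> Zh \<Omega> \<T>" and \<Omega>: "open \<Omega>" "bounded \<Omega>"
  shows "(\<lambda>x. q x - r x) \<in> Zh \<Omega> \<T>"
proof -
  have H: "q \<in> Hdiv \<Omega>" "r \<in> Hdiv \<Omega>"
    using q r by (simp_all add: Zh_def)
  note dq = Hdiv_weak_div[OF H(1) \<Omega>(1)] and dr = Hdiv_weak_div[OF H(2) \<Omega>(1)]
  have "(\<lambda>x. q x - r x) \<in> Hdiv \<Omega>"
    using weak_div_diff(1)[OF dq dr \<Omega>(1)] square_integrable_diff[OF dq(2) dr(2)] H square_integrable_diff
    unfolding Hdiv_def by blast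
  moreover have "zero_normal_trace \<Omega> (\<lambda>x. q x - r x)"
    using q r H by (intro zero_normal_trace_diff \<Omega>) (simp_all add: Zh_def)
  moreover have "piecewise_P1 \<T> (\<lambda>x. q x - r x)"
    using q r by (intro piecewise_P1_diff) (simp_all add: Zh_def)
  ultimately show ?thesis
    by (simp add: Zh_def)
qed

lemma H1_vec_weak_div:
  assumes v: "v \<in> H1_vec \<Omega>" and \<Omega>: "open \<Omega>"
  shows "is_weak_div \<Omega> v (weak_div \<Omega> v)" "square_integrable (lebesgue_on \<Omega>) (weak_div \<Omega> v)"
proof -
  have vi: "(\<lambda>x. v x $ i) \<in> H1 \<Omega>" for i
    using v by (simp add: H1_vec_def)
  let ?d = "\<lambda>x. \<Sum>i\<in>UNIV. weak_grad \<Omega> (\<lambda>y. v y $ i) x $ i"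
  have d: "is_weak_div \<Omega> v ?d"
    by (intro is_weak_div_sum_weak_grad H1_weak_grad vi \<Omega>)
  have sq: "square_integrable (lebesgue_on \<Omega>) ?d"
    by (intro square_integrable_sum square_integrable_component H1_weak_grad vi \<Omega>)
  show "is_weak_div \<Omega> v (weak_div \<Omega> v)"
    using d by (rule is_weak_div_weak_div)
  show "square_integrable (lebesgue_on \<Omega>) (weak_div \<Omega> v)"
    using d sq \<Omega> by (rule weak_div_square_integrable)
qed

lemma strain_square_integrable:
  assumes v: "v \<in> H1_vec \<Omega>" and \<Omega>: "open \<Omega>"
  shows "square_integrable (lebesgue_on \<Omega>) (strain \<Omega> v)"
proof -
  have J: "square_integrable (lebesgue_on \<Omega>) (\<lambda>x. weak_jacobian \<Omega> v x $ i)" for i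
    using H1_weak_grad(2)[of "\<lambda>y. v y $ i" \<Omega>] v \<Omega> by (simp add: weak_jacobian_def H1_vec_def)
  have "square_integrable (lebesgue_on \<Omega>) (\<lambda>x. transpose (weak_jacobian \<Omega> v x))"
    by (intro square_integrable_vecI) (simp add: transpose_def square_integrable_component[OF J])
  moreover have "square_integrable (lebesgue_on \<Omega>) (weak_jacobian \<Omega> v)"
    by (intro square_integrable_vecI J)
  ultimately show ?thesis
    unfolding strain_def by (intro square_integrable_scaleR square_integrable_add)
qed

lemma strain_diff_AE:
  fixes \<Omega> :: "(real^'n) set"
  assumes v: "v \<in> H1_vec \<Omega>" and w: "w \<in> H1_vec \<Omega>" and \<Omega>: "open \<Omega>"
  shows "AE x in lebesgue_on \<Omega>. strain \<Omega> (\<lambda>y. v y - w y) x = strain \<Omega> v x - strain \<Omega> w x"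
proof -
  have "AE x in lebesgue_on \<Omega>. \<forall>i\<in>UNIV. weak_grad \<Omega> (\<lambda>y. v y $ i - w y $ i) x
      = weak_grad \<Omega> (\<lambda>y. v y $ i) x - weak_grad \<Omega> (\<lambda>y. w y $ i) x"
    using v w \<Omega> by (intro AE_finite_allI weak_grad_diff_AE) (auto simp: H1_vec_def)
  then show ?thesis
  proof eventually_elim
    case (elim x)
    then have "weak_jacobian \<Omega> (\<lambda>y. v y - w y) x = weak_jacobian \<Omega> v x - weak_jacobian \<Omega> w x"
      by (simp add: weak_jacobian_def vec_eq_iff)
    moreover have "transpose (A - B) = transpose A - transpose B" for A B :: "real^'n^'n"
      by (simp add: transpose_def vec_eq_iff)
    ultimately show ?case
      by (simp add: strain_def scaleR_diff_right scaleR_add_right)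
  qed
qed

section \<open>The permeability tensor\<close>

lemma square_integrable_matrix_inv_mult:
  assumes K: "permeability_tensor \<Omega> K" and q: "square_integrable (lebesgue_on \<Omega>) q"
  shows "square_integrable (lebesgue_on \<Omega>) (\<lambda>x. matrix_inv (K x) *v q x)"
proof -
  obtain c where c: "c > 0" "\<And>x \<xi>. x \<in> \<Omega> \<Longrightarrow> c * (\<xi> \<bullet> \<xi>) \<le> \<xi> \<bullet> (K x *v \<xi>)"
    using K by (auto simp: permeability_tensor_def)
  have sym: "x \<in> \<Omega> \<Longrightarrow> transpose (K x) = K x" for x
    using K by (simp add: permeability_tensor_def)
  note coer = coercive_matrix_inv[OF sym c(1) c(2)]
  show ?thesis
  proof (rule square_integrable_bound[OF q])
    show "(\<lambda>x. matrix_inv (K x) *v q x) \<in> borel_measurable (lebesgue_on \<Omega>)"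
      using K q coer(1) by (intro borel_measurable_matrix_inv_mult)
        (auto simp: permeability_tensor_def square_integrable_def)
    show "norm (matrix_inv (K x) *v q x) \<le> 1 / c * norm (q x)" if "x \<in> space (lebesgue_on \<Omega>)" for x
      using coer(4) that by simp
  qed
qed

text \<open>An identity of the integrands, so neither the measurability of the square root nor the integrability
of \<open>q\<close> plays a role.\<close>

lemma L2_norm_matrix_sqrt_matrix_inv:
  assumes K: "permeability_tensor \<Omega> K"
  shows "(L2_norm (lebesgue_on \<Omega>) (\<lambda>x. matrix_sqrt (matrix_inv (K x)) *v q x))\<^sup>2
    = L2_inner (lebesgue_on \<Omega>) (\<lambda>x. matrix_inv (K x) *v q x) q"
proof -
  obtain c where c: "c > 0" "\<And>x \<xi>. x \<in> \<Omega> \<Longrightarrow> c * (\<xi> \<bullet> \<xi>) \<le> \<xi> \<bullet> (K x *v \<xi>)"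
    using K by (auto simp: permeability_tensor_def)
  have sym: "x \<in> \<Omega> \<Longrightarrow> transpose (K x) = K x" for x
    using K by (simp add: permeability_tensor_def)
  note coer = coercive_matrix_inv[OF sym c(1) c(2)]
  show ?thesis
    unfolding L2_norm_power2 unfolding L2_inner_def
  proof (rule Bochner_Integration.integral_cong)
    fix x assume "x \<in> space (lebesgue_on \<Omega>)"
    then have "x \<in> \<Omega>"
      by simp
    then show "(matrix_sqrt (matrix_inv (K x)) *v q x) \<bullet> (matrix_sqrt (matrix_inv (K x)) *v q x)
        = (matrix_inv (K x) *v q x) \<bullet> q x"
      using coer(2,3)[of x] c(1) by (intro matrix_sqrt_inner_self[of _ "1 / c"]) auto
  qed simp
qed

section \<open>Contraction of the fixed stress split\<close>

text \<open>The four scalar relations from which the contraction follows.  The variables stand for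
\<open>a = \<parallel>\<delta>p\<parallel>\<^sup>2\<close>, \<open>b = (div \<delta>u, \<delta>p)\<close>, \<open>d = \<parallel>div \<delta>u\<parallel>\<^sup>2\<close>, \<open>e = \<parallel>\<epsilon>(\<delta>u)\<parallel>\<^sup>2\<close> and \<open>\<zeta> = (K\<^sup>-\<^sup>1 \<delta>z, \<delta>z)\<close> at the new
iterate, \<open>S\<close> and \<open>s\<close> for the squared norms of the new and the old stress increment, and \<open>r\<close> for the
inner product of the old stress increment with \<open>\<delta>p\<close>.\<close>

lemma fixed_stress_algebra:
  fixes lam G \<alpha> \<beta> \<mu>f dt a b d e r s S \<zeta> :: real
  assumes pos: "lam > 0" "\<beta> > 0"
    and stress: "S = lam\<^sup>2 * d - 2 * \<alpha> * lam * b + \<alpha>\<^sup>2 * a"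
    and mech: "2 * G * e + lam * d \<le> \<alpha> * b"
    and flow: "\<alpha>\<^sup>2 * \<beta> * a + dt / \<mu>f * \<zeta> = - (\<alpha> / lam) * r"
    and young: "0 \<le> (1 / (lam * \<beta>))\<^sup>2 * s + 2 * (\<alpha> / (lam * \<beta>)) * r + \<alpha>\<^sup>2 * a"
  shows "S + 2 * dt / (\<mu>f * \<beta>) * \<zeta> + 4 * G * lam * e + lam\<^sup>2 * d \<le> (1 / (lam * \<beta>))\<^sup>2 * s"
proof -
  have "S + 4 * G * lam * e + lam\<^sup>2 * d = 2 * lam * (2 * G * e + lam * d - \<alpha> * b) + \<alpha>\<^sup>2 * a"
    by (simp add: stress power2_eq_square algebra_simps)
  also have "\<dots> \<le> \<alpha>\<^sup>2 * a"
    using mech pos by (simp add: mult_le_0_iff)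
  finally have 1: "S + 4 * G * lam * e + lam\<^sup>2 * d \<le> \<alpha>\<^sup>2 * a" .
  have "2 * \<alpha>\<^sup>2 * a + 2 * dt / (\<mu>f * \<beta>) * \<zeta> = 2 / \<beta> * (\<alpha>\<^sup>2 * \<beta> * a + dt / \<mu>f * \<zeta>)"
    using pos by (simp add: field_simps)
  also have "\<dots> = - 2 * (\<alpha> / (lam * \<beta>)) * r"
    unfolding flow by (simp add: field_simps)
  finally show ?thesis
    using 1 young by linarith
qed

theorem theorem1:
  fixes \<Omega> \<Gamma>1 \<Gamma>2 \<Gamma>3 :: "(real^'n) set"
    and \<F> :: "(real^'n) set set set" and \<T> :: "(real^'n) set set"
    and lam G \<alpha> M cf \<phi>0 \<mu>f dt \<rho>fr grav \<beta> :: real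
    and K :: "real^'n \<Rightarrow> real^'n^'n"
    and ga \<eta> qh :: "real^'n \<Rightarrow> real"
    and f0 f2 :: "real^'n \<Rightarrow> real^'n"
    and p_prev :: "real^'n \<Rightarrow> real" and u_prev :: "real^'n \<Rightarrow> real^'n"
    and p :: "nat \<Rightarrow> real^'n \<Rightarrow> real"
    and z u :: "nat \<Rightarrow> real^'n \<Rightarrow> real^'n"
    and \<delta>\<sigma> :: "nat \<Rightarrow> real^'n \<Rightarrow> real"
  assumes dim: "CARD('n) = 2 \<or> CARD('n) = 3"
    and domain: "open \<Omega>" "connected \<Omega>" "\<Omega> \<noteq> {}" "bounded \<Omega>" "smooth_boundary \<Omega>"
    and boundary_parts: "frontier \<Omega> = \<Gamma>1 \<union> \<Gamma>2 \<union> \<Gamma>3"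
      "\<Gamma>1 \<inter> \<Gamma>2 = {}" "\<Gamma>1 \<inter> \<Gamma>3 = {}" "\<Gamma>2 \<inter> \<Gamma>3 = {}"
      "\<Gamma>1 \<in> sets surface_measure" "\<Gamma>2 \<in> sets surface_measure" "\<Gamma>3 \<in> sets surface_measure"
      "emeasure surface_measure \<Gamma>1 > 0"
    and parameters: "lam > 0" "G > 0" "\<alpha> > 0" "M > 0" "cf \<ge> 0" "\<phi>0 \<ge> 0" "\<mu>f > 0" "dt > 0"
    and permeability: "permeability_tensor \<Omega> K"
    and gap: "\<forall>x\<in>\<Gamma>3. ga x \<ge> 0"
    and data: "square_integrable (lebesgue_on \<Omega>) f0" "square_integrable (surface_on \<Gamma>2) f2"
      "square_integrable (lebesgue_on \<Omega>) qh"
      "\<exists>D. is_weak_grad \<Omega> (\<lambda>x. \<rho>fr * grav * \<eta> x) D \<and> square_integrable (lebesgue_on \<Omega>) D"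
    and mesh: "regular_family \<Omega> \<F>" "\<T> \<in> \<F>"
    and previous_step: "p_prev \<in> Qh \<Omega> \<T>" "u_prev \<in> Vh \<Omega> \<Gamma>1 \<Gamma>3 ga \<T>"
    and start: "p 0 \<in> Qh \<Omega> \<T>" "u 0 \<in> Vh \<Omega> \<Gamma>1 \<Gamma>3 ga \<T>"
    and flow_spaces: "\<forall>n. p (Suc n) \<in> Qh \<Omega> \<T> \<and> z (Suc n) \<in> Zh \<Omega> \<T>"
    and flow_mass: "\<forall>n. \<forall>\<theta>\<in>Qh \<Omega> \<T>.
      L2_inner (lebesgue_on \<Omega>)
        (\<lambda>x. (1 / M + cf * \<phi>0 + \<alpha>\<^sup>2 / lam) * ((p (Suc n) x - p_prev x) / dt)) \<theta>
      + 1 / \<mu>f * L2_inner (lebesgue_on \<Omega>) (weak_div \<Omega> (z (Suc n))) \<theta>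
      = L2_inner (lebesgue_on \<Omega>)
          (\<lambda>x. - (\<alpha> / lam) * (- \<alpha> * ((p n x - p_prev x) / dt)
             + lam * weak_div \<Omega> (\<lambda>y. (u n y - u_prev y) /\<^sub>R dt) x)) \<theta>
        + L2_inner (lebesgue_on \<Omega>) qh \<theta>"
    and flow_darcy: "\<forall>n. \<forall>q\<in>Zh \<Omega> \<T>.
      L2_inner (lebesgue_on \<Omega>) (\<lambda>x. matrix_inv (K x) *v z (Suc n) x) q
      = L2_inner (lebesgue_on \<Omega>) (p (Suc n)) (weak_div \<Omega> q)
        + L2_inner (lebesgue_on \<Omega>) (weak_grad \<Omega> (\<lambda>x. \<rho>fr * grav * \<eta> x)) q"
    and mechanics_space: "\<forall>n. u (Suc n) \<in> Vh \<Omega> \<Gamma>1 \<Gamma>3 ga \<T>"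
    and mechanics: "\<forall>n. \<forall>v\<in>Vh \<Omega> \<Gamma>1 \<Gamma>3 ga \<T>.
      2 * G * L2_inner (lebesgue_on \<Omega>) (strain \<Omega> (u (Suc n)))
        (\<lambda>x. strain \<Omega> v x - strain \<Omega> (u (Suc n)) x)
      + L2_inner (lebesgue_on \<Omega>) (\<lambda>x. lam * weak_div \<Omega> (u (Suc n)) x)
          (\<lambda>x. weak_div \<Omega> v x - weak_div \<Omega> (u (Suc n)) x)
      - \<alpha> * L2_inner (lebesgue_on \<Omega>) (p (Suc n))
          (\<lambda>x. weak_div \<Omega> v x - weak_div \<Omega> (u (Suc n)) x)
      \<ge> L2_inner (lebesgue_on \<Omega>) f0 (\<lambda>x. v x - u (Suc n) x)
        + L2_inner (surface_on \<Gamma>2) f2 (\<lambda>x. vtrace \<Omega> v x - vtrace \<Omega> (u (Suc n)) x)"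
    and stress_increment: "\<forall>n\<ge>1. \<delta>\<sigma> n =
      (\<lambda>x. lam * weak_div \<Omega> (increment u n) x - \<alpha> * increment p n x)"
    and beta: "\<beta> = 1 / (M * \<alpha>\<^sup>2) + cf / \<alpha>\<^sup>2 * \<phi>0 + 1 / lam"
  shows "(1 / (lam * \<beta>))\<^sup>2 < 1 \<and>
    (\<forall>n\<ge>1.
      (L2_norm (lebesgue_on \<Omega>) (\<delta>\<sigma> (n + 1)))\<^sup>2
      + 2 * dt / (\<mu>f * \<beta>) * (L2_norm (lebesgue_on \<Omega>)
          (\<lambda>x. matrix_sqrt (matrix_inv (K x)) *v increment z (n + 1) x))\<^sup>2
      + 4 * G * lam * (L2_norm (lebesgue_on \<Omega>) (strain \<Omega> (increment u (n + 1))))\<^sup>2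
      + lam\<^sup>2 * (L2_norm (lebesgue_on \<Omega>) (weak_div \<Omega> (increment u (n + 1))))\<^sup>2
      \<le> (1 / (lam * \<beta>))\<^sup>2 * (L2_norm (lebesgue_on \<Omega>) (\<delta>\<sigma> n))\<^sup>2)"
proof (intro conjI allI impI)
  let ?L = "lebesgue_on \<Omega>"
  have \<Omega>: "open \<Omega>" "bounded \<Omega>"
    using domain by auto
  have \<beta>_gt: "lam * \<beta> \<ge> 1 + lam / (M * \<alpha>\<^sup>2)"
    using parameters by (simp add: beta field_simps)
  moreover have "lam / (M * \<alpha>\<^sup>2) > 0"
    using parameters by simp
  ultimately have lam\<beta>: "lam * \<beta> > 1"
    by linarith
  then have \<beta>: "\<beta> > 0"
    using parameters by (smt (verit) mult_nonneg_nonpos)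
  show "(1 / (lam * \<beta>))\<^sup>2 < 1"
  proof -
    have "0 < 1 / (lam * \<beta>)" "1 / (lam * \<beta>) < 1"
      using lam\<beta> by simp_all
    then show ?thesis
      unfolding power2_less_1_iff by linarith
  qed
  fix n :: nat
  assume "n \<ge> 1"
  then obtain m where n: "n = Suc m"
    by (cases n) auto
  have pQ: "p k \<in> Qh \<Omega> \<T>" for k
    using start flow_spaces by (cases k) auto
  have uV: "u k \<in> Vh \<Omega> \<Gamma>1 \<Gamma>3 ga \<T>" for k
    using start mechanics_space by (cases k) auto
  have uH: "u k \<in> H1_vec \<Omega>" "u_prev \<in> H1_vec \<Omega>" for k
    using uV[of k] previous_step by (auto simp: Vh_def Vu_def)
  \<comment> \<open>Index \<open>0\<close> of the flux is unconstrained, so only fluxes with index at least \<open>1\<close> may be used.\<close>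
  have zZ: "z (Suc k) \<in> Zh \<Omega> \<T>" for k
    using flow_spaces by auto
  have sq_p: "square_integrable ?L (p k)" "square_integrable ?L p_prev" for k
    using pQ[of k] previous_step by (auto simp: Qh_def)
  have sq_z: "square_integrable ?L (z (Suc k))" "z (Suc k) \<in> Hdiv \<Omega>" for k
    using zZ[of k] by (auto simp: Zh_def Hdiv_def)
  define D where "D k = weak_div \<Omega> (u k)" for k
  define W where "W k = weak_div \<Omega> (z k)" for k
  define E where "E k = strain \<Omega> (u k)" for k
  note D = H1_vec_weak_div[OF uH(1) \<Omega>(1), folded D_def]
  note D_prev = H1_vec_weak_div[OF uH(2) \<Omega>(1)]
  note W = Hdiv_weak_div[OF sq_z(2) \<Omega>(1), folded W_def]
  have E: "square_integrable ?L (E k)" for k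
    unfolding E_def by (rule strain_square_integrable[OF uH(1) \<Omega>(1)])
  have inc: "increment w (Suc k) = (\<lambda>x. w (Suc k) x - w k x)" for w :: "nat \<Rightarrow> real^'n \<Rightarrow> 'b::minus" and k
    by (simp add: increment_def fun_eq_iff)
  define dp where "dp = (\<lambda>x. p (Suc n) x - p n x)"
  define dz where "dz = (\<lambda>x. z (Suc n) x - z n x)"
  define dD where "dD k = (\<lambda>x. D (Suc k) x - D k x)" for k
  define dE where "dE = (\<lambda>x. E (Suc n) x - E n x)"
  define dW where "dW = (\<lambda>x. W (Suc n) x - W n x)"
  have dpQ: "dp \<in> Qh \<Omega> \<T>"
    unfolding dp_def by (intro Qh_diff pQ)
  have dzZ: "dz \<in> Zh \<Omega> \<T>"
    unfolding dz_def n by (intro Zh_diff zZ \<Omega>)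
  have sq_dp: "square_integrable ?L dp"
    using dpQ by (simp add: Qh_def)
  have sq_dz: "square_integrable ?L dz"
    using dzZ by (simp add: Zh_def Hdiv_def)
  have sq_dD: "square_integrable ?L (dD k)" for k
    unfolding dD_def by (intro square_integrable_diff D)
  have sq_dE: "square_integrable ?L dE"
    unfolding dE_def by (intro square_integrable_diff E)
  have sq_dW: "square_integrable ?L dW"
    unfolding dW_def n by (intro square_integrable_diff W)

  have div_inc: "AE x in ?L. weak_div \<Omega> (increment u (Suc k)) x = dD k x"
    "square_integrable ?L (weak_div \<Omega> (increment u (Suc k)))" for k
    using weak_div_diff(2,3)[OF D(1)[of "Suc k", unfolded D_def] D(2)[of "Suc k", unfolded D_def]
        D(1)[of k, unfolded D_def] D(2)[of k, unfolded D_def] \<Omega>(1)]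
    by (simp_all add: inc dD_def D_def)
  have div_dz: "AE x in ?L. weak_div \<Omega> dz x = dW x" "square_integrable ?L (weak_div \<Omega> dz)"
    using weak_div_diff(2,3)[OF Hdiv_weak_div[OF sq_z(2)[of n] \<Omega>(1)]
        Hdiv_weak_div[OF sq_z(2)[of m] \<Omega>(1)] \<Omega>(1)]
    by (simp_all add: dz_def dW_def W_def n)
  have strain_inc: "AE x in ?L. strain \<Omega> (increment u (Suc n)) x = dE x"
    using strain_diff_AE[OF uH(1)[of "Suc n"] uH(1)[of n] \<Omega>(1)] by (simp add: inc dE_def E_def)

  \<comment> \<open>\<open>\<delta>\<sigma>\<close> is defined through the weak divergence of an increment; almost everywhere it is a difference \<open>dS\<close> of the fields \<open>s\<close>.\<close>
  define s where "s k = (\<lambda>x. lam * D k x - \<alpha> * p k x)" for k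
  have sq_s: "square_integrable ?L (s k)" for k
    unfolding s_def using square_integrable_scaleR[OF D(2)[of k], of lam]
      square_integrable_scaleR[OF sq_p(1)[of k], of \<alpha>] by (intro square_integrable_diff) auto
  define dS where "dS k = (\<lambda>x. lam * dD k x - \<alpha> * (p (Suc k) x - p k x))" for k
  have dS_eq: "dS k = (\<lambda>x. s (Suc k) x - s k x)" for k
    by (simp add: dS_def s_def dD_def fun_eq_iff algebra_simps)
  have sq_dS: "square_integrable ?L (dS k)" for k
    unfolding dS_eq by (intro square_integrable_diff sq_s)
  have \<delta>\<sigma>: "(L2_norm ?L (\<delta>\<sigma> (Suc k)))\<^sup>2 = L2_inner ?L (dS k) (dS k)" for k
  proof -
    have ae: "AE x in ?L. \<delta>\<sigma> (Suc k) x = dS k x"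
      using div_inc(1)[of k] stress_increment[rule_format, of "Suc k"]
      by (auto simp: dS_def inc elim!: eventually_mono)
    have "\<delta>\<sigma> (Suc k) \<in> borel_measurable ?L"
      using sq_dS[of k] \<Omega> by (intro borel_measurable_lebesgue_on_cong_AE[OF _ _ ae]) (auto simp: square_integrable_def)
    then show ?thesis
      unfolding L2_norm_power2 using ae sq_dS[of k]
      by (intro L2_inner_cong_AE) (auto simp: square_integrable_def)
  qed

  let ?C = "1 / M + cf * \<phi>0 + \<alpha>\<^sup>2 / lam"
  have C: "?C = \<alpha>\<^sup>2 * \<beta>"
    using parameters by (simp add: beta field_simps)
  define s0 where "s0 = (\<lambda>x. lam * weak_div \<Omega> u_prev x - \<alpha> * p_prev x)"
  have sq_s0: "square_integrable ?L s0"
    unfolding s0_def using square_integrable_scaleR[OF D_prev(2), of lam]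
      square_integrable_scaleR[OF sq_p(2), of \<alpha>] by (intro square_integrable_diff) auto
  have mass: "?C / dt * (L2_inner ?L (p (Suc k)) dp - L2_inner ?L p_prev dp) + 1 / \<mu>f * L2_inner ?L (W (Suc k)) dp
      = - (\<alpha> / (lam * dt)) * (L2_inner ?L (s k) dp - L2_inner ?L s0 dp) + L2_inner ?L qh dp" for k
  proof -
    have "(\<lambda>x. ?C * ((p (Suc k) x - p_prev x) / dt)) = (\<lambda>x. ?C / dt * (p (Suc k) x - p_prev x))"
      by (simp add: fun_eq_iff)
    then have lhs: "L2_inner ?L (\<lambda>x. ?C * ((p (Suc k) x - p_prev x) / dt)) dp
        = ?C / dt * (L2_inner ?L (p (Suc k)) dp - L2_inner ?L p_prev dp)"
      by (simp only: L2_inner_mult_left L2_inner_diff_left[OF sq_p(1) sq_p(2) sq_dp])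
    let ?V = "weak_div \<Omega> (\<lambda>y. (u k y - u_prev y) /\<^sub>R dt)"
    have div: "is_weak_div \<Omega> (\<lambda>y. (u k y - u_prev y) /\<^sub>R dt) (\<lambda>x. inverse dt * (D k x - weak_div \<Omega> u_prev x))"
      by (intro is_weak_div_scaleR is_weak_div_diff D D_prev \<Omega>)
    have sq_div: "square_integrable ?L (\<lambda>x. inverse dt * (D k x - weak_div \<Omega> u_prev x))"
      using square_integrable_scaleR[OF square_integrable_diff[OF D(2)[of k] D_prev(2)], of "inverse dt"] by simp
    have V: "?V \<in> borel_measurable ?L"
      using weak_div_square_integrable[OF div sq_div \<Omega>(1)] by (simp add: square_integrable_def)
    let ?R = "\<lambda>x. - (\<alpha> / lam) * (- \<alpha> * ((p k x - p_prev x) / dt) + lam * ?V x)"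
    let ?R' = "\<lambda>x. - (\<alpha> / (lam * dt)) * (s k x - s0 x)"
    have "L2_inner ?L ?R dp = L2_inner ?L ?R' dp"
    proof (rule L2_inner_cong_AE)
      show "AE x in ?L. ?R x = ?R' x"
        using weak_div_AE_eq[OF div \<Omega>(1)]
      proof eventually_elim
        case (elim x)
        show ?case
          unfolding elim using parameters by (simp add: s_def s0_def field_simps)
      qed
      show "?R \<in> borel_measurable ?L"
        using V sq_p(1)[of k] sq_p(2) unfolding square_integrable_def by (intro borel_measurable_times borel_measurable_add
            borel_measurable_diff borel_measurable_divide borel_measurable_const) auto
      show "?R' \<in> borel_measurable ?L"
        using sq_s[of k] sq_s0 unfolding square_integrable_def by (intro borel_measurable_times
            borel_measurable_diff borel_measurable_const) auto
    qed (use sq_dp in \<open>auto simp: square_integrable_def\<close>)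
    also have "\<dots> = - (\<alpha> / (lam * dt)) * (L2_inner ?L (s k) dp - L2_inner ?L s0 dp)"
      by (simp only: L2_inner_mult_left L2_inner_diff_left[OF sq_s sq_s0 sq_dp])
    finally show ?thesis
      using bspec[OF spec[OF flow_mass, of k] dpQ] lhs by (simp only: W_def)
  qed
  \<comment> \<open>Subtract the mass balances of two consecutive iterations, both tested with \<open>\<delta>p\<close>.\<close>
  have flow: "\<alpha>\<^sup>2 * \<beta> * L2_inner ?L dp dp + dt / \<mu>f * L2_inner ?L dW dp = - (\<alpha> / lam) * L2_inner ?L (dS m) dp"
  proof -
    have "?C / dt * L2_inner ?L dp dp + 1 / \<mu>f * L2_inner ?L dW dp
        = - (\<alpha> / (lam * dt)) * L2_inner ?L (dS m) dp"
    proof -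
      have e1: "L2_inner ?L dp dp = L2_inner ?L (p (Suc n)) dp - L2_inner ?L (p n) dp"
        using L2_inner_diff_left[OF sq_p(1)[of "Suc n"] sq_p(1)[of n] sq_dp] by (simp add: dp_def[symmetric])
      have e2: "L2_inner ?L dW dp = L2_inner ?L (W (Suc n)) dp - L2_inner ?L (W n) dp"
        unfolding dW_def n by (intro L2_inner_diff_left W sq_dp)
      have e3: "L2_inner ?L (dS m) dp = L2_inner ?L (s n) dp - L2_inner ?L (s m) dp"
        unfolding dS_eq n by (intro L2_inner_diff_left sq_s sq_dp)
      show ?thesis
        using mass[of n] mass[of m, folded n] unfolding e1 e2 e3 right_diff_distrib by linarith
    qed
    from arg_cong[OF this, of "(*) dt"] show ?thesis
      unfolding C using parameters by (simp add: distrib_left)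
  qed

  let ?Kz = "\<lambda>k x. matrix_inv (K x) *v z k x"
  \<comment> \<open>Subtract the Darcy equations, both tested with \<open>\<delta>z\<close>; the gravity terms cancel.\<close>
  have darcy: "L2_inner ?L (\<lambda>x. matrix_inv (K x) *v dz x) dz = L2_inner ?L dW dp"
  proof -
    have "L2_inner ?L (\<lambda>x. matrix_inv (K x) *v dz x) dz = L2_inner ?L (\<lambda>x. ?Kz (Suc n) x - ?Kz n x) dz"
      by (simp add: dz_def matrix_vector_mult_diff_distrib)
    also have "\<dots> = L2_inner ?L (?Kz (Suc n)) dz - L2_inner ?L (?Kz n) dz"
      unfolding n by (intro L2_inner_diff_left square_integrable_matrix_inv_mult permeability sq_z sq_dz)
    also have "\<dots> = L2_inner ?L (p (Suc n)) (weak_div \<Omega> dz) - L2_inner ?L (p n) (weak_div \<Omega> dz)"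
      using bspec[OF spec[OF flow_darcy, of n] dzZ] bspec[OF spec[OF flow_darcy, of m] dzZ] unfolding n by linarith
    also have "\<dots> = L2_inner ?L dp (weak_div \<Omega> dz)"
      unfolding dp_def by (intro L2_inner_diff_left[symmetric] sq_p div_dz)
    also have "\<dots> = L2_inner ?L dp dW"
      using sq_dp div_dz sq_dW by (intro L2_inner_cong_AE) (auto simp: square_integrable_def)
    finally show ?thesis
      by (simp add: L2_inner_commute)
  qed

  have mech: "2 * G * L2_inner ?L dE dE + lam * L2_inner ?L (dD n) (dD n) \<le> \<alpha> * L2_inner ?L (dD n) dp"
  proof -
    \<comment> \<open>Each inequality is tested with the other iterate; the load terms on the right-hand sides then cancel.\<close>
    note m1 = bspec[OF spec[OF mechanics, of n] uV[of n], folded D_def E_def]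
    note m2 = bspec[OF spec[OF mechanics, of m] uV[of "Suc n"], folded D_def E_def, folded n]
    have swap: "L2_inner ?L f (\<lambda>x. D n x - D (Suc n) x) = - L2_inner ?L f (dD n)"
      "L2_inner ?L g (\<lambda>x. E n x - E (Suc n) x) = - L2_inner ?L g dE"
      "L2_inner ?L f0 (\<lambda>x. u n x - u (Suc n) x) = - L2_inner ?L f0 (\<lambda>x. u (Suc n) x - u n x)"
      "L2_inner (surface_on \<Gamma>2) f2 (\<lambda>x. vtrace \<Omega> (u n) x - vtrace \<Omega> (u (Suc n)) x)
        = - L2_inner (surface_on \<Gamma>2) f2 (\<lambda>x. vtrace \<Omega> (u (Suc n)) x - vtrace \<Omega> (u n) x)" for f g
      unfolding dD_def dE_def by (rule L2_inner_diff_swap)+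
    have e1: "L2_inner ?L dE dE = L2_inner ?L (E (Suc n)) dE - L2_inner ?L (E n) dE"
      using L2_inner_diff_left[OF E[of "Suc n"] E[of n] sq_dE] by (simp add: dE_def[symmetric])
    have e2: "L2_inner ?L (dD n) (dD n) = L2_inner ?L (D (Suc n)) (dD n) - L2_inner ?L (D n) (dD n)"
      using L2_inner_diff_left[OF D(2)[of "Suc n"] D(2)[of n] sq_dD[of n]] by (simp add: dD_def[symmetric])
    have e3: "L2_inner ?L (dD n) dp = L2_inner ?L (p (Suc n)) (dD n) - L2_inner ?L (p n) (dD n)"
      using L2_inner_diff_left[OF sq_p(1)[of "Suc n"] sq_p(1)[of n] sq_dD[of n]]
      by (simp add: dp_def[symmetric] L2_inner_commute)
    show ?thesis
      using m1[unfolded swap L2_inner_mult_left] m2[folded dD_def dE_def, unfolded L2_inner_mult_left]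
      unfolding e1 e2 e3 right_diff_distrib by linarith
  qed

  have stress: "L2_inner ?L (dS n) (dS n) = lam\<^sup>2 * L2_inner ?L (dD n) (dD n)
      - 2 * \<alpha> * lam * L2_inner ?L (dD n) dp + \<alpha>\<^sup>2 * L2_inner ?L dp dp"
    using L2_inner_lincomb_self[OF sq_dD[of n] sq_dp, of lam \<alpha>] by (simp add: dS_def dp_def mult_ac)
  \<comment> \<open>This is the squared norm of \<open>1 / (lam * \<beta>)\<close> times the old stress increment plus \<open>\<alpha>\<close> times \<open>\<delta>p\<close>.\<close>
  have young: "0 \<le> (1 / (lam * \<beta>))\<^sup>2 * L2_inner ?L (dS m) (dS m)
      + 2 * (\<alpha> / (lam * \<beta>)) * L2_inner ?L (dS m) dp + \<alpha>\<^sup>2 * L2_inner ?L dp dp"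
    using L2_inner_self_nonneg[of ?L "\<lambda>x. 1 / (lam * \<beta>) * dS m x - (- \<alpha>) * dp x"]
    unfolding L2_inner_lincomb_self[OF sq_dS sq_dp] by (simp add: mult_ac)

  have "(L2_norm ?L (strain \<Omega> (increment u (n + 1))))\<^sup>2 = L2_inner ?L dE dE"
  proof -
    have "strain \<Omega> (increment u (Suc n)) \<in> borel_measurable ?L"
      using sq_dE \<Omega> by (intro borel_measurable_lebesgue_on_cong_AE[OF _ _ strain_inc]) (auto simp: square_integrable_def)
    then show ?thesis
      unfolding L2_norm_power2 using strain_inc sq_dE
      by (intro L2_inner_cong_AE) (auto simp: square_integrable_def)
  qed
  moreover have "(L2_norm ?L (weak_div \<Omega> (increment u (n + 1))))\<^sup>2 = L2_inner ?L (dD n) (dD n)"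
    unfolding L2_norm_power2 using div_inc[of n] sq_dD[of n]
    by (intro L2_inner_cong_AE) (auto simp: square_integrable_def)
  moreover have "(L2_norm ?L (\<lambda>x. matrix_sqrt (matrix_inv (K x)) *v increment z (n + 1) x))\<^sup>2
      = L2_inner ?L dW dp"
    using L2_norm_matrix_sqrt_matrix_inv[OF permeability, of dz] darcy by (simp add: inc dz_def)
  ultimately show "(L2_norm ?L (\<delta>\<sigma> (n + 1)))\<^sup>2
      + 2 * dt / (\<mu>f * \<beta>) * (L2_norm ?L (\<lambda>x. matrix_sqrt (matrix_inv (K x)) *v increment z (n + 1) x))\<^sup>2
      + 4 * G * lam * (L2_norm ?L (strain \<Omega> (increment u (n + 1))))\<^sup>2
      + lam\<^sup>2 * (L2_norm ?L (weak_div \<Omega> (increment u (n + 1))))\<^sup>2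
      \<le> (1 / (lam * \<beta>))\<^sup>2 * (L2_norm ?L (\<delta>\<sigma> n))\<^sup>2"
    using fixed_stress_algebra[OF parameters(1) \<beta> stress mech flow young] \<delta>\<sigma>[of n] \<delta>\<sigma>[of m]
    by (simp add: n)
qed

end
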